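(* Let $(\mathcal A,\mathcal B,\mathcal C)$ be a recollement of abelian categories with functors $i\colon\mathcal A\to\mathcal B$ and $e\colon\mathcal B\to\mathcal C$, and assume that $\mathcal B$ and $\mathcal C$ have enough projective and injective objects. Assume that the functor $e$ is an eventually homological isomorphism. Then the following hold: - $(\alpha)$ $\sup\{\operatorname{id}_{\mathcal B}i(A)\mid A\in\mathcal A\}<\infty$; - $(\beta)$ $\sup\{\operatorname{pd}_{\mathcal C}e(P)\mid P\in\operatorname{Proj}\mathcal B\}<\infty$; - $(\gamma)$ $\sup\{\operatorname{pd}_{\mathcal B}i(A)\mid A\in\mathcal A\}<\infty$; - $(\delta)$ $\sup\{\operatorname{id}_{\mathcal C}e(I)\mid I\in\operatorname{Inj}\mathcal B\}<\infty$. In particular, if $e$ is a $t$-homological isomorphism for a nonnegative integer $t$, then each of the four suprema $\sup\{\operatorname{id}_{\mathcal B}i(A)\mid A\in\mathcal A\}$, $\sup\{\operatorname{pd}_{\mathcal C}e(P)\mid P\in\operatorname{Proj}\mathcal B\}$, $\sup\{\operatorname{pd}_{\mathcal B}i(A)\mid A\in\mathcal A\}$ and $\sup\{\operatorname{id}_{\mathcal C}e(I)\mid I\in\operatorname{Inj}\mathcal B\}$ is bounded by $t$.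
   Context: A recollement $(\mathcal A,\mathcal B,\mathcal C)$ of abelian categories consists of abelian categories and additive functors $i\colon\mathcal A\to\mathcal B$, $e\colon\mathcal B\to\mathcal C$, $q,p\colon\mathcal B\to\mathcal A$, $l,r\colon\mathcal C\to\mathcal B$ such that $l\dashv e\dashv r$ and $q\dashv i\dashv p$ are adjoint triples, $i,l,r$ are fully faithful, and the essential image of $i$ equals $\operatorname{Ker}e=\{B\mid e(B)=0\}$. $\operatorname{Proj}$ and $\operatorname{Inj}$ denote the classes of projective and injective objects; $\operatorname{pd}$ and $\operatorname{id}$ are projective and injective dimension. A functor $f\colon\mathcal D\to\mathcal F$ between abelian categories is a $t$-homological isomorphism ($t$ an integer) if there is an isomorphism $\operatorname{Ext}^j_{\mathcal D}(X,Y)\cong\operatorname{Ext}^j_{\mathcal F}(f(X),f(Y))$ for all objects $X,Y$ of $\mathcal D$ and all $j>t$; it is an eventually homological isomorphism if it is a $t$-homological isomorphism for some $t$. *)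

theory Defs
  imports "HOL-Algebra.Coset" "HOL-Library.Extended_Nat"
begin

section \<open>Additive and abelian categories\<close>

text \<open>
  A category enriched in abelian groups is given by a set of objects and a set of arrows inside
  arbitrary types. Composition is written in function order: \<open>g \<star> f\<close> means first \<open>f\<close>, then \<open>g\<close>.
  The operations are meaningful only on composable (respectively parallel) arrows.
\<close>

record ('o, 'm) cat =
  Obj :: "'o set"
  Arr :: "'m set"
  Dom :: "'m \<Rightarrow> 'o"
  Cod :: "'m \<Rightarrow> 'o"
  Ident :: "'o \<Rightarrow> 'm"
  Comp :: "'m \<Rightarrow> 'm \<Rightarrow> 'm"  (infixl "\<star>\<index>" 70)
  Plus :: "'m \<Rightarrow> 'm \<Rightarrow> 'm"  (infixl "\<boxplus>\<index>" 65)
  Zero :: "'o \<Rightarrow> 'o \<Rightarrow> 'm"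

definition Hom :: "('o, 'm) cat \<Rightarrow> 'o \<Rightarrow> 'o \<Rightarrow> 'm set" where
  "Hom C X Y = {f \<in> Arr C. Dom C f = X \<and> Cod C f = Y}"

definition hom_group :: "('o, 'm) cat \<Rightarrow> 'o \<Rightarrow> 'o \<Rightarrow> 'm monoid" where
  "hom_group C X Y = \<lparr>carrier = Hom C X Y, mult = Plus C, one = Zero C X Y\<rparr>"

locale category =
  fixes C :: "('o, 'm) cat" (structure)
  assumes Dom_in_Obj: "f \<in> Arr C \<Longrightarrow> Dom C f \<in> Obj C"
    and Cod_in_Obj: "f \<in> Arr C \<Longrightarrow> Cod C f \<in> Obj C"
    and Ident_in_Hom: "X \<in> Obj C \<Longrightarrow> Ident C X \<in> Hom C X X"
    and Comp_in_Hom: "\<lbrakk>f \<in> Hom C X Y; g \<in> Hom C Y Z\<rbrakk> \<Longrightarrow> g \<star> f \<in> Hom C X Z"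
    and Comp_assoc: "\<lbrakk>f \<in> Hom C W X; g \<in> Hom C X Y; h \<in> Hom C Y Z\<rbrakk> \<Longrightarrow>
                       (h \<star> g) \<star> f = h \<star> (g \<star> f)"
    and Comp_Ident_right: "f \<in> Hom C X Y \<Longrightarrow> f \<star> Ident C X = f"
    and Comp_Ident_left: "f \<in> Hom C X Y \<Longrightarrow> Ident C Y \<star> f = f"

locale preadditive_category = category +
  assumes hom_comm_group: "\<lbrakk>X \<in> Obj C; Y \<in> Obj C\<rbrakk> \<Longrightarrow> comm_group (hom_group C X Y)"
    and Comp_Plus_right: "\<lbrakk>f \<in> Hom C X Y; f' \<in> Hom C X Y; g \<in> Hom C Y Z\<rbrakk> \<Longrightarrow>
                            g \<star> (f \<boxplus> f') = (g \<star> f) \<boxplus> (g \<star> f')"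
    and Comp_Plus_left: "\<lbrakk>f \<in> Hom C X Y; g \<in> Hom C Y Z; g' \<in> Hom C Y Z\<rbrakk> \<Longrightarrow>
                            (g \<boxplus> g') \<star> f = (g \<star> f) \<boxplus> (g' \<star> f)"

definition is_zero_object :: "('o, 'm) cat \<Rightarrow> 'o \<Rightarrow> bool" where
  "is_zero_object C Z \<longleftrightarrow> Z \<in> Obj C \<and>
     (\<forall>X \<in> Obj C. (\<exists>!f. f \<in> Hom C X Z) \<and> (\<exists>!f. f \<in> Hom C Z X))"

definition isomorphic_objects :: "('o, 'm) cat \<Rightarrow> 'o \<Rightarrow> 'o \<Rightarrow> bool" where
  "isomorphic_objects C X Y \<longleftrightarrow>
     (\<exists>f \<in> Hom C X Y. \<exists>g \<in> Hom C Y X. g \<star>\<^bsub>C\<^esub> f = Ident C X \<and> f \<star>\<^bsub>C\<^esub> g = Ident C Y)"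

definition is_biproduct ::
  "('o, 'm) cat \<Rightarrow> 'o \<Rightarrow> 'o \<Rightarrow> 'o \<Rightarrow> 'm \<Rightarrow> 'm \<Rightarrow> 'm \<Rightarrow> 'm \<Rightarrow> bool" where
  "is_biproduct C X Y S inX inY prX prY \<longleftrightarrow>
     inX \<in> Hom C X S \<and> inY \<in> Hom C Y S \<and> prX \<in> Hom C S X \<and> prY \<in> Hom C S Y \<and>
     prX \<star>\<^bsub>C\<^esub> inX = Ident C X \<and> prY \<star>\<^bsub>C\<^esub> inY = Ident C Y \<and>
     prY \<star>\<^bsub>C\<^esub> inX = Zero C X Y \<and> prX \<star>\<^bsub>C\<^esub> inY = Zero C Y X \<and>
     (inX \<star>\<^bsub>C\<^esub> prX) \<boxplus>\<^bsub>C\<^esub> (inY \<star>\<^bsub>C\<^esub> prY) = Ident C S"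

definition is_mono :: "('o, 'm) cat \<Rightarrow> 'm \<Rightarrow> bool" where
  "is_mono C f \<longleftrightarrow> f \<in> Arr C \<and>
     (\<forall>W \<in> Obj C. \<forall>g \<in> Hom C W (Dom C f). \<forall>h \<in> Hom C W (Dom C f).
        f \<star>\<^bsub>C\<^esub> g = f \<star>\<^bsub>C\<^esub> h \<longrightarrow> g = h)"

definition is_epi :: "('o, 'm) cat \<Rightarrow> 'm \<Rightarrow> bool" where
  "is_epi C f \<longleftrightarrow> f \<in> Arr C \<and>
     (\<forall>W \<in> Obj C. \<forall>g \<in> Hom C (Cod C f) W. \<forall>h \<in> Hom C (Cod C f) W.
        g \<star>\<^bsub>C\<^esub> f = h \<star>\<^bsub>C\<^esub> f \<longrightarrow> g = h)"

definition is_kernel :: "('o, 'm) cat \<Rightarrow> 'm \<Rightarrow> 'm \<Rightarrow> bool" where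
  "is_kernel C f k \<longleftrightarrow> f \<in> Arr C \<and> k \<in> Arr C \<and> Cod C k = Dom C f \<and>
     f \<star>\<^bsub>C\<^esub> k = Zero C (Dom C k) (Cod C f) \<and>
     (\<forall>W \<in> Obj C. \<forall>g \<in> Hom C W (Dom C f). f \<star>\<^bsub>C\<^esub> g = Zero C W (Cod C f) \<longrightarrow>
        (\<exists>!h. h \<in> Hom C W (Dom C k) \<and> k \<star>\<^bsub>C\<^esub> h = g))"

definition is_cokernel :: "('o, 'm) cat \<Rightarrow> 'm \<Rightarrow> 'm \<Rightarrow> bool" where
  "is_cokernel C f c \<longleftrightarrow> f \<in> Arr C \<and> c \<in> Arr C \<and> Dom C c = Cod C f \<and>
     c \<star>\<^bsub>C\<^esub> f = Zero C (Dom C f) (Cod C c) \<and>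
     (\<forall>W \<in> Obj C. \<forall>g \<in> Hom C (Cod C f) W. g \<star>\<^bsub>C\<^esub> f = Zero C (Dom C f) W \<longrightarrow>
        (\<exists>!h. h \<in> Hom C (Cod C c) W \<and> h \<star>\<^bsub>C\<^esub> c = g))"

locale abelian_category = preadditive_category +
  assumes ex_zero_object: "\<exists>Z. is_zero_object C Z"
    and ex_biproduct: "\<lbrakk>X \<in> Obj C; Y \<in> Obj C\<rbrakk> \<Longrightarrow>
                         \<exists>S inX inY prX prY. is_biproduct C X Y S inX inY prX prY"
    and ex_kernel: "f \<in> Arr C \<Longrightarrow> \<exists>k. is_kernel C f k"
    and ex_cokernel: "f \<in> Arr C \<Longrightarrow> \<exists>c. is_cokernel C f c"
    and mono_normal: "is_mono C f \<Longrightarrow> \<exists>g. is_kernel C g f"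
    and epi_conormal: "is_epi C f \<Longrightarrow> \<exists>g. is_cokernel C g f"


section \<open>Exactness, resolutions and homological dimensions\<close>

definition is_image :: "('o, 'm) cat \<Rightarrow> 'm \<Rightarrow> 'm \<Rightarrow> bool" where
  "is_image C f m \<longleftrightarrow> (\<exists>c. is_cokernel C f c \<and> is_kernel C c m)"

text \<open>
  \<open>exact_pair C f g\<close>: the sequence with first map \<open>f\<close> and second map \<open>g\<close> is exact at
  \<open>Cod f = Dom g\<close>, that is, the image of \<open>f\<close> is the kernel of \<open>g\<close>.
\<close>

definition exact_pair :: "('o, 'm) cat \<Rightarrow> 'm \<Rightarrow> 'm \<Rightarrow> bool" where
  "exact_pair C f g \<longleftrightarrow> (\<exists>m. is_image C f m \<and> is_kernel C g m)"

definition projective_obj :: "('o, 'm) cat \<Rightarrow> 'o \<Rightarrow> bool" where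
  "projective_obj C P \<longleftrightarrow> P \<in> Obj C \<and>
     (\<forall>g f. is_epi C g \<longrightarrow> f \<in> Hom C P (Cod C g) \<longrightarrow> (\<exists>h \<in> Hom C P (Dom C g). g \<star>\<^bsub>C\<^esub> h = f))"

definition injective_obj :: "('o, 'm) cat \<Rightarrow> 'o \<Rightarrow> bool" where
  "injective_obj C I \<longleftrightarrow> I \<in> Obj C \<and>
     (\<forall>g f. is_mono C g \<longrightarrow> f \<in> Hom C (Dom C g) I \<longrightarrow> (\<exists>h \<in> Hom C (Cod C g) I. h \<star>\<^bsub>C\<^esub> g = f))"

definition Proj :: "('o, 'm) cat \<Rightarrow> 'o set" where
  "Proj C = {P. projective_obj C P}"

definition Inj :: "('o, 'm) cat \<Rightarrow> 'o set" where
  "Inj C = {I. injective_obj C I}"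

definition enough_projectives :: "('o, 'm) cat \<Rightarrow> bool" where
  "enough_projectives C \<longleftrightarrow> (\<forall>X \<in> Obj C. \<exists>P \<in> Proj C. \<exists>f \<in> Hom C P X. is_epi C f)"

definition enough_injectives :: "('o, 'm) cat \<Rightarrow> bool" where
  "enough_injectives C \<longleftrightarrow> (\<forall>X \<in> Obj C. \<exists>I \<in> Inj C. \<exists>f \<in> Hom C X I. is_mono C f)"

text \<open>
  A projective resolution \<open>\<dots> \<rightarrow> P\<^sub>2 \<rightarrow> P\<^sub>1 \<rightarrow> P\<^sub>0 \<rightarrow> X \<rightarrow> 0\<close> is encoded by its sequence of
  maps: \<open>d 0\<close> is the augmentation \<open>P\<^sub>0 \<rightarrow> X\<close>, and \<open>d (Suc n)\<close> is the differential
  \<open>P\<^sub>n\<^sub>+\<^sub>1 \<rightarrow> P\<^sub>n\<close>; thus \<open>P\<^sub>n = Dom (d n)\<close>. Dually for an injective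
  resolution \<open>0 \<rightarrow> X \<rightarrow> I\<^sub>0 \<rightarrow> I\<^sub>1 \<rightarrow> \<dots>\<close>, where \<open>I\<^sub>n = Cod (d n)\<close>.
\<close>

definition projective_resolution :: "('o, 'm) cat \<Rightarrow> 'o \<Rightarrow> (nat \<Rightarrow> 'm) \<Rightarrow> bool" where
  "projective_resolution C X d \<longleftrightarrow>
     is_epi C (d 0) \<and> Cod C (d 0) = X \<and>
     (\<forall>n. Dom C (d n) \<in> Proj C \<and> exact_pair C (d (Suc n)) (d n))"

definition injective_resolution :: "('o, 'm) cat \<Rightarrow> 'o \<Rightarrow> (nat \<Rightarrow> 'm) \<Rightarrow> bool" where
  "injective_resolution C X d \<longleftrightarrow>
     is_mono C (d 0) \<and> Dom C (d 0) = X \<and>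
     (\<forall>n. Cod C (d n) \<in> Inj C \<and> exact_pair C (d n) (d (Suc n)))"

text \<open>
  The dimension is the least length of a resolution, and \<open>\<infinity>\<close> (the infimum of the empty set) if
  there is no finite one. The zero object gets dimension 0.
\<close>

definition proj_dim :: "('o, 'm) cat \<Rightarrow> 'o \<Rightarrow> enat" where
  "proj_dim C X = Inf {enat n | n. \<exists>d. projective_resolution C X d \<and>
                                     (\<forall>k>n. is_zero_object C (Dom C (d k)))}"

definition inj_dim :: "('o, 'm) cat \<Rightarrow> 'o \<Rightarrow> enat" where
  "inj_dim C X = Inf {enat n | n. \<exists>d. injective_resolution C X d \<and>
                                    (\<forall>k>n. is_zero_object C (Cod C (d k)))}"


section \<open>Extension groups\<close>

text \<open>
  \<open>Ext\<^sup>n(X,Y)\<close> is the \<open>n\<close>-th cohomology group of the complex of abelian groups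
  \<open>0 \<rightarrow> Hom(P\<^sub>0,Y) \<rightarrow> Hom(P\<^sub>1,Y) \<rightarrow> \<dots>\<close> for a projective resolution \<open>P\<close> of \<open>X\<close>. The
  resolution is an arbitrary chosen one; by the comparison theorem the group does not depend on it
  up to isomorphism. This is intended for abelian categories with enough projectives.
\<close>

definition ext_cocycles :: "('o, 'm) cat \<Rightarrow> (nat \<Rightarrow> 'm) \<Rightarrow> nat \<Rightarrow> 'o \<Rightarrow> 'm set" where
  "ext_cocycles C d n Y =
     {f \<in> Hom C (Dom C (d n)) Y. f \<star>\<^bsub>C\<^esub> d (Suc n) = Zero C (Dom C (d (Suc n))) Y}"

definition ext_coboundaries :: "('o, 'm) cat \<Rightarrow> (nat \<Rightarrow> 'm) \<Rightarrow> nat \<Rightarrow> 'o \<Rightarrow> 'm set" where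
  "ext_coboundaries C d n Y =
     (case n of 0 \<Rightarrow> {Zero C (Dom C (d 0)) Y}
              | Suc m \<Rightarrow> (\<lambda>g. g \<star>\<^bsub>C\<^esub> d n) ` Hom C (Dom C (d m)) Y)"

definition ext_via :: "('o, 'm) cat \<Rightarrow> (nat \<Rightarrow> 'm) \<Rightarrow> nat \<Rightarrow> 'o \<Rightarrow> 'm set monoid" where
  "ext_via C d n Y =
     (hom_group C (Dom C (d n)) Y)\<lparr>carrier := ext_cocycles C d n Y\<rparr> Mod ext_coboundaries C d n Y"

definition Ext :: "('o, 'm) cat \<Rightarrow> nat \<Rightarrow> 'o \<Rightarrow> 'o \<Rightarrow> 'm set monoid" where
  "Ext C n X Y = ext_via C (SOME d. projective_resolution C X d) n Y"


section \<open>Functors and recollements\<close>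

record ('o1, 'm1, 'o2, 'm2) ftor =
  on_ob :: "'o1 \<Rightarrow> 'o2"
  on_ar :: "'m1 \<Rightarrow> 'm2"

definition additive_functor ::
  "('o1, 'm1) cat \<Rightarrow> ('o2, 'm2) cat \<Rightarrow> ('o1, 'm1, 'o2, 'm2) ftor \<Rightarrow> bool" where
  "additive_functor C D F \<longleftrightarrow>
     (\<forall>X \<in> Obj C. on_ob F X \<in> Obj D \<and> on_ar F (Ident C X) = Ident D (on_ob F X)) \<and>
     (\<forall>X Y. \<forall>f \<in> Hom C X Y. on_ar F f \<in> Hom D (on_ob F X) (on_ob F Y)) \<and>
     (\<forall>X Y Z. \<forall>f \<in> Hom C X Y. \<forall>g \<in> Hom C Y Z.
        on_ar F (g \<star>\<^bsub>C\<^esub> f) = on_ar F g \<star>\<^bsub>D\<^esub> on_ar F f) \<and>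
     (\<forall>X Y. \<forall>f \<in> Hom C X Y. \<forall>g \<in> Hom C X Y.
        on_ar F (f \<boxplus>\<^bsub>C\<^esub> g) = on_ar F f \<boxplus>\<^bsub>D\<^esub> on_ar F g)"

definition fully_faithful ::
  "('o1, 'm1) cat \<Rightarrow> ('o2, 'm2) cat \<Rightarrow> ('o1, 'm1, 'o2, 'm2) ftor \<Rightarrow> bool" where
  "fully_faithful C D F \<longleftrightarrow>
     (\<forall>X \<in> Obj C. \<forall>Y \<in> Obj C. bij_betw (on_ar F) (Hom C X Y) (Hom D (on_ob F X) (on_ob F Y)))"

text \<open>\<open>left_adjoint C D F G\<close>: \<open>F : C \<rightarrow> D\<close> is left adjoint to \<open>G : D \<rightarrow> C\<close>.\<close>

definition left_adjoint ::
  "('o1, 'm1) cat \<Rightarrow> ('o2, 'm2) cat \<Rightarrow>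
   ('o1, 'm1, 'o2, 'm2) ftor \<Rightarrow> ('o2, 'm2, 'o1, 'm1) ftor \<Rightarrow> bool" where
  "left_adjoint C D F G \<longleftrightarrow>
     (\<exists>\<phi>. (\<forall>X \<in> Obj C. \<forall>Y \<in> Obj D.
             bij_betw (\<phi> X Y) (Hom D (on_ob F X) Y) (Hom C X (on_ob G Y))) \<and>
          (\<forall>X \<in> Obj C. \<forall>X' \<in> Obj C. \<forall>Y \<in> Obj D. \<forall>Y' \<in> Obj D.
             \<forall>u \<in> Hom C X' X. \<forall>v \<in> Hom D Y Y'. \<forall>f \<in> Hom D (on_ob F X) Y.
               \<phi> X' Y' (v \<star>\<^bsub>D\<^esub> f \<star>\<^bsub>D\<^esub> on_ar F u) = on_ar G v \<star>\<^bsub>C\<^esub> \<phi> X Y f \<star>\<^bsub>C\<^esub> u))"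

definition essential_image ::
  "('o1, 'm1) cat \<Rightarrow> ('o2, 'm2) cat \<Rightarrow> ('o1, 'm1, 'o2, 'm2) ftor \<Rightarrow> 'o2 set" where
  "essential_image C D F = {Y \<in> Obj D. \<exists>X \<in> Obj C. isomorphic_objects D (on_ob F X) Y}"

definition functor_kernel ::
  "('o1, 'm1) cat \<Rightarrow> ('o2, 'm2) cat \<Rightarrow> ('o1, 'm1, 'o2, 'm2) ftor \<Rightarrow> 'o1 set" where
  "functor_kernel C D F = {X \<in> Obj C. is_zero_object D (on_ob F X)}"

locale recollement =
  fixes A :: "('oA, 'mA) cat" and B :: "('oB, 'mB) cat" and C :: "('oC, 'mC) cat"
    and i :: "('oA, 'mA, 'oB, 'mB) ftor" and e :: "('oB, 'mB, 'oC, 'mC) ftor"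
    and q p :: "('oB, 'mB, 'oA, 'mA) ftor" and l r :: "('oC, 'mC, 'oB, 'mB) ftor"
  assumes abelian: "abelian_category A" "abelian_category B" "abelian_category C"
    and functors: "additive_functor A B i" "additive_functor B C e"
      "additive_functor B A q" "additive_functor B A p"
      "additive_functor C B l" "additive_functor C B r"
    and adj_l_e: "left_adjoint C B l e" and adj_e_r: "left_adjoint B C e r"
    and adj_q_i: "left_adjoint B A q i" and adj_i_p: "left_adjoint A B i p"
    and full_faith: "fully_faithful A B i" "fully_faithful C B l" "fully_faithful C B r"
    and image_i: "essential_image A B i = functor_kernel B C e"

text \<open>
  The isomorphisms are isomorphisms of abelian groups; they are not required to be induced by the
  functor or to be natural. The threshold is an integer, but degrees range over the natural numbers
  only, since extension groups in negative degrees vanish.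
\<close>

definition homological_iso ::
  "int \<Rightarrow> ('o1, 'm1) cat \<Rightarrow> ('o2, 'm2) cat \<Rightarrow> ('o1, 'm1, 'o2, 'm2) ftor \<Rightarrow> bool" where
  "homological_iso t D F f \<longleftrightarrow>
     (\<forall>X \<in> Obj D. \<forall>Y \<in> Obj D. \<forall>j::nat. int j > t \<longrightarrow>
        Ext D j X Y \<cong> Ext F j (on_ob f X) (on_ob f Y))"

definition eventually_homological_iso ::
  "('o1, 'm1) cat \<Rightarrow> ('o2, 'm2) cat \<Rightarrow> ('o1, 'm1, 'o2, 'm2) ftor \<Rightarrow> bool" where
  "eventually_homological_iso D F f \<longleftrightarrow> (\<exists>t. homological_iso t D F f)"

end

theory Submission
  imports Defs
begin

text \<open>
  Since \<open>e i = 0\<close>, a \<open>t\<close>-homological isomorphism \<open>e\<close> forces \<open>Ext\<^sup>t\<^sup>+\<^sup>1(-, i A)\<close> and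
  \<open>Ext\<^sup>t\<^sup>+\<^sup>1(i A, -)\<close> to vanish on \<open>B\<close>, which bounds the injective and the projective dimension
  of \<open>i A\<close>. For \<open>P\<close> projective, \<open>Ext\<^sup>t\<^sup>+\<^sup>1(e P, e Y) \<cong> Ext\<^sup>t\<^sup>+\<^sup>1(P, Y) = 0\<close>; as \<open>e r\<close> is isomorphic
  to the identity, every object of \<open>C\<close> is of the form \<open>e Y\<close>, so \<open>e P\<close> has projective dimension
  at most \<open>t\<close>; similarly for \<open>e I\<close> with \<open>I\<close> injective.

  Only the vanishing of Ext matters, never its group structure, so one can argue on cocycles of a
  fixed projective resolution \<open>d\<close> and needs no comparison theorem. If \<open>Ext\<^sup>1(X, -)\<close> vanishes, then
  the cocycle \<open>P\<^sub>1 \<rightarrow> K\<close> onto the first syzygy is a coboundary, which splits \<open>P\<^sub>0 \<rightarrow> X\<close>. For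
  injective dimensions, embed \<open>Y\<close> into an injective \<open>I\<close> with cokernel \<open>Y'\<close>: the vanishing of
  \<open>Ext\<^sup>n\<^sup>+\<^sup>2(X, Y)\<close> passes to \<open>Ext\<^sup>n\<^sup>+\<^sup>1(X, Y')\<close> on the same resolution of \<open>X\<close>, and the vanishing of
  \<open>Ext\<^sup>1(Y', Y)\<close> splits \<open>I \<rightarrow> Y'\<close>.
\<close>

section \<open>The opposite category\<close>

text \<open>Formalizes duality: a statement about epimorphisms, cokernels or injective dimension is
  the statement about monomorphisms, kernels or projective dimension at \<open>op_cat C\<close>, and
  the simp rules below translate it back.\<close>

definition op_cat :: "('o, 'm) cat \<Rightarrow> ('o, 'm) cat" where
  "op_cat C = \<lparr>Obj = Obj C, Arr = Arr C, Dom = Cod C, Cod = Dom C, Ident = Ident C,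
     Comp = (\<lambda>g f. f \<star>\<^bsub>C\<^esub> g), Plus = Plus C, Zero = (\<lambda>X Y. Zero C Y X)\<rparr>"

lemma op_cat_simps [simp]:
  "Obj (op_cat C) = Obj C" "Arr (op_cat C) = Arr C" "Dom (op_cat C) = Cod C"
  "Cod (op_cat C) = Dom C" "Ident (op_cat C) = Ident C"
  "g \<star>\<^bsub>op_cat C\<^esub> f = f \<star>\<^bsub>C\<^esub> g" "Plus (op_cat C) = Plus C"
  "Zero (op_cat C) X Y = Zero C Y X"
  by (simp_all add: op_cat_def)

lemma Hom_op_cat [simp]: "Hom (op_cat C) X Y = Hom C Y X"
  by (auto simp: Hom_def)

lemma hom_group_op_cat [simp]: "hom_group (op_cat C) X Y = hom_group C Y X"
  by (simp add: hom_group_def)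

lemma is_zero_object_op_cat [simp]: "is_zero_object (op_cat C) Z = is_zero_object C Z"
  by (auto simp: is_zero_object_def)

lemma is_mono_op_cat [simp]: "is_mono (op_cat C) f = is_epi C f"
  by (simp add: is_mono_def is_epi_def)

lemma is_epi_op_cat [simp]: "is_epi (op_cat C) f = is_mono C f"
  by (simp add: is_mono_def is_epi_def)

lemma is_kernel_op_cat [simp]: "is_kernel (op_cat C) f k = is_cokernel C f k"
  by (auto simp: is_kernel_def is_cokernel_def)

lemma is_cokernel_op_cat [simp]: "is_cokernel (op_cat C) f k = is_kernel C f k"
  by (auto simp: is_kernel_def is_cokernel_def)

lemma projective_obj_op_cat [simp]: "projective_obj (op_cat C) X = injective_obj C X"
  by (simp add: projective_obj_def injective_obj_def)

lemma Proj_op_cat [simp]: "Proj (op_cat C) = Inj C"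
  by (simp add: Proj_def Inj_def)


section \<open>Preadditive categories\<close>

context category
begin

section \<open>Cancellation and composition of monomorphisms and epimorphisms\<close>

lemma HomD:
  assumes "f \<in> Hom C X Y"
  shows "f \<in> Arr C" "Dom C f = X" "Cod C f = Y" "X \<in> Obj C" "Y \<in> Obj C"
  using assms Dom_in_Obj Cod_in_Obj by (auto simp: Hom_def)

lemma Arr_Hom: "f \<in> Arr C \<Longrightarrow> f \<in> Hom C (Dom C f) (Cod C f)"
  by (simp add: Hom_def)

lemma mono_cancel:
  assumes "is_mono C f" "f \<in> Hom C X Y" "g \<in> Hom C W X" "h \<in> Hom C W X" "f \<star> g = f \<star> h"
  shows "g = h"
  using assms HomD[OF assms(2)] HomD[OF assms(3)] unfolding is_mono_def by blast

lemma epi_cancel: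
  assumes "is_epi C f" "f \<in> Hom C X Y" "g \<in> Hom C Y W" "h \<in> Hom C Y W" "g \<star> f = h \<star> f"
  shows "g = h"
  using assms HomD[OF assms(2)] HomD[OF assms(3)] unfolding is_epi_def by blast

text \<open>The domain of an arrow is always an object, so \<open>W\<close> can range over the whole
  type. This is the working form of \<open>is_mono\<close> for an arrow with named ends.\<close>

lemma mono_iff:
  assumes "f \<in> Hom C X Y"
  shows "is_mono C f \<longleftrightarrow> (\<forall>W. \<forall>g \<in> Hom C W X. \<forall>h \<in> Hom C W X. f \<star> g = f \<star> h \<longrightarrow> g = h)"
  unfolding is_mono_def using HomD[OF assms] HomD(4) by metis

lemma op_category: "category (op_cat C)"
  by unfold_locales
    (auto intro: Dom_in_Obj Cod_in_Obj Ident_in_Hom Comp_in_Hom Comp_Ident_left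
      Comp_Ident_right Comp_assoc[symmetric])

lemma epi_iff:
  assumes "f \<in> Hom C X Y"
  shows "is_epi C f \<longleftrightarrow> (\<forall>W. \<forall>g \<in> Hom C Y W. \<forall>h \<in> Hom C Y W. g \<star> f = h \<star> f \<longrightarrow> g = h)"
  using category.mono_iff[OF op_category, of f Y X] assms by simp

lemma mono_comp:
  assumes "is_mono C f" "is_mono C g" "f \<in> Hom C X Y" "g \<in> Hom C Y Z"
  shows "is_mono C (g \<star> f)"
  unfolding mono_iff[OF Comp_in_Hom[OF assms(3,4)]]
proof (intro allI ballI impI)
  fix W a b assume a: "a \<in> Hom C W X" and b: "b \<in> Hom C W X" and eq: "g \<star> f \<star> a = g \<star> f \<star> b"
  have "g \<star> (f \<star> a) = g \<star> (f \<star> b)"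
    using eq Comp_assoc[OF a assms(3,4)] Comp_assoc[OF b assms(3,4)] by simp
  then have "f \<star> a = f \<star> b"
    using mono_cancel[OF assms(2,4)] Comp_in_Hom[OF a assms(3)] Comp_in_Hom[OF b assms(3)] by blast
  then show "a = b" using mono_cancel[OF assms(1,3) a b] by blast
qed

lemma epi_comp:
  assumes "is_epi C f" "is_epi C g" "f \<in> Hom C X Y" "g \<in> Hom C Y Z"
  shows "is_epi C (g \<star> f)"
  using category.mono_comp[OF op_category, of g f Z Y X] assms by simp

text \<open>A section \<open>g\<close> of \<open>f\<close> is enough: composing with
  \<open>g\<close> on the right cancels \<open>f\<close>.\<close>

lemma iso_epi:
  assumes "f \<in> Hom C X Y" "g \<in> Hom C Y X" "f \<star> g = Ident C Y"
  shows "is_epi C f"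
  unfolding epi_iff[OF assms(1)]
proof (intro allI ballI impI)
  fix W a b assume a: "a \<in> Hom C Y W" and b: "b \<in> Hom C Y W" and eq: "a \<star> f = b \<star> f"
  have "a \<star> f \<star> g = b \<star> f \<star> g" using eq by simp
  then have "a \<star> (f \<star> g) = b \<star> (f \<star> g)"
    using Comp_assoc[OF assms(2,1) a] Comp_assoc[OF assms(2,1) b] by simp
  then show "a = b" using Comp_Ident_right[OF a] Comp_Ident_right[OF b] assms(3) by simp
qed

lemma Ident_mono: "X \<in> Obj C \<Longrightarrow> is_mono C (Ident C X)"
  by (simp add: mono_iff[OF Ident_in_Hom] Comp_Ident_left)

lemma Ident_epi: "X \<in> Obj C \<Longrightarrow> is_epi C (Ident C X)"
  by (simp add: epi_iff[OF Ident_in_Hom] Comp_Ident_right)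

section \<open>Lifting along epimorphisms, and retracts\<close>

lemma projective_lift:
  assumes "projective_obj C P" "is_epi C g" "g \<in> Hom C X Y" "f \<in> Hom C P Y"
  obtains h where "h \<in> Hom C P X" "g \<star> h = f"
  using assms HomD[OF assms(3)] unfolding projective_obj_def by blast

text \<open>An arrow out of \<open>X\<close> becomes an arrow out of \<open>P\<close> through
  \<open>u\<close>; lift it there and restrict the lift along \<open>s\<close>.\<close>

lemma projective_retract:
  assumes "projective_obj C P" "u \<in> Hom C P X" "s \<in> Hom C X P" "u \<star> s = Ident C X"
  shows "projective_obj C X"
  unfolding projective_obj_def
proof (intro conjI allI impI)
  show "X \<in> Obj C" using HomD[OF assms(3)] by blast
  fix g f assume g: "is_epi C g" and f: "f \<in> Hom C X (Cod C g)"
  have gH: "g \<in> Hom C (Dom C g) (Cod C g)" using g Arr_Hom unfolding is_epi_def by blast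
  obtain h where h: "h \<in> Hom C P (Dom C g)" "g \<star> h = f \<star> u"
    using projective_lift[OF assms(1) g gH Comp_in_Hom[OF assms(2) f]] .
  have "g \<star> (h \<star> s) = f \<star> (u \<star> s)"
    using Comp_assoc[OF assms(3) h(1) gH] Comp_assoc[OF assms(3,2) f] h(2) by simp
  then have "g \<star> (h \<star> s) = f" using assms(4) Comp_Ident_right[OF f] by simp
  then show "\<exists>h \<in> Hom C X (Dom C g). g \<star> h = f" using Comp_in_Hom[OF assms(3) h(1)] by blast
qed

lemma injective_retract:
  assumes "injective_obj C I" "u \<in> Hom C I Y" "s \<in> Hom C Y I" "u \<star> s = Ident C Y"
  shows "injective_obj C Y"
  using category.projective_retract[OF op_category, of I s Y u] assms by simp

end

context preadditive_category
begin

section \<open>Zero arrows and differences of parallel arrows\<close>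

lemma Zero_in_Hom: "X \<in> Obj C \<Longrightarrow> Y \<in> Obj C \<Longrightarrow> Zero C X Y \<in> Hom C X Y"
  using monoid.one_closed[OF group.is_monoid[OF comm_group.axioms(2)[OF hom_comm_group]]]
  by (fastforce simp: hom_group_def)

lemma op_preadditive: "preadditive_category (op_cat C)"
  by (intro preadditive_category.intro op_category preadditive_category_axioms.intro)
    (simp_all add: Comp_Plus_left Comp_Plus_right hom_comm_group)

lemma Comp_Zero_right:
  assumes "g \<in> Hom C Y Z" "X \<in> Obj C"
  shows "g \<star> Zero C X Y = Zero C X Z"
proof -
  have Y: "Y \<in> Obj C" and Z: "Z \<in> Obj C" using HomD[OF assms(1)] by auto
  interpret G: comm_group "hom_group C X Y" using hom_comm_group[OF assms(2) Y] .
  interpret H: comm_group "hom_group C X Z" using hom_comm_group[OF assms(2) Z] .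
  let ?z = "Zero C X Y"
  have z: "?z \<in> Hom C X Y" using Zero_in_Hom[OF assms(2) Y] .
  \<comment> \<open>The zero arrow is idempotent for addition, hence so is its composite with
    \<open>g\<close>, and a group has only one idempotent.\<close>
  have "?z \<boxplus> ?z = ?z" using G.l_one[of ?z] z by (simp add: hom_group_def)
  then have "(g \<star> ?z) \<boxplus> (g \<star> ?z) = g \<star> ?z" using Comp_Plus_right[OF z z assms(1)] by simp
  then show ?thesis using H.l_cancel_one[of "g \<star> ?z" "g \<star> ?z"] Comp_in_Hom[OF z assms(1)]
    by (simp add: hom_group_def)
qed

lemma Comp_Zero_left:
  assumes "g \<in> Hom C X Y" "Z \<in> Obj C"
  shows "Zero C Y Z \<star> g = Zero C X Z"
  using preadditive_category.Comp_Zero_right[OF op_preadditive, of g Y X Z] assms by simp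

text \<open>The hom group is read off from the ends of the first argument, so that differences can
  be written as a plain infix operation.\<close>

definition Minus :: "'b \<Rightarrow> 'b \<Rightarrow> 'b"  (infixl "\<boxminus>" 65) where
  "f \<boxminus> g = f \<boxplus> inv\<^bsub>hom_group C (Dom C f) (Cod C f)\<^esub> g"

lemma Minus_in_Hom:
  assumes "f \<in> Hom C X Y" "g \<in> Hom C X Y"
  shows "f \<boxminus> g \<in> Hom C X Y"
proof -
  interpret G: comm_group "hom_group C X Y" using hom_comm_group HomD[OF assms(1)] by blast
  show ?thesis using assms G.m_closed[of f "inv\<^bsub>hom_group C X Y\<^esub> g"] G.inv_closed[of g]
      HomD[OF assms(1)] by (simp add: hom_group_def Minus_def)
qed

text \<open>Trades a difference for a sum, so that distributivity of composition over
  \<open>Minus\<close> follows from that over \<open>Plus\<close> without group inverses.\<close>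

lemma Minus_iff:
  assumes "f \<in> Hom C X Y" "g \<in> Hom C X Y" "h \<in> Hom C X Y"
  shows "f \<boxminus> g = h \<longleftrightarrow> h \<boxplus> g = f"
proof -
  interpret G: comm_group "hom_group C X Y" using hom_comm_group HomD[OF assms(1)] by blast
  have Minus: "f \<boxminus> g = f \<otimes>\<^bsub>hom_group C X Y\<^esub> inv\<^bsub>hom_group C X Y\<^esub> g"
    using HomD[OF assms(1)] by (simp add: hom_group_def Minus_def)
  have Plus: "h \<boxplus> g = h \<otimes>\<^bsub>hom_group C X Y\<^esub> g" by (simp add: hom_group_def)
  have f: "f \<in> carrier (hom_group C X Y)" and g: "g \<in> carrier (hom_group C X Y)"
    and h: "h \<in> carrier (hom_group C X Y)" using assms by (simp_all add: hom_group_def)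
  show ?thesis unfolding Minus Plus using G.inv_solve_right'[OF h f g] by metis
qed

lemma Minus_Zero:
  assumes "f \<in> Hom C X Y"
  shows "f \<boxminus> Zero C X Y = f"
proof -
  have X: "X \<in> Obj C" "Y \<in> Obj C" using HomD[OF assms] by auto
  interpret G: comm_group "hom_group C X Y" using hom_comm_group X by blast
  have "f \<boxplus> Zero C X Y = f" using G.r_one[of f] assms by (simp add: hom_group_def)
  then show ?thesis using Minus_iff[OF assms Zero_in_Hom[OF X] assms] by simp
qed

lemma Minus_eq_Zero_iff:
  assumes "f \<in> Hom C X Y" "g \<in> Hom C X Y"
  shows "f \<boxminus> g = Zero C X Y \<longleftrightarrow> f = g"
proof -
  have X: "X \<in> Obj C" "Y \<in> Obj C" using HomD[OF assms(1)] by auto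
  interpret G: comm_group "hom_group C X Y" using hom_comm_group X by blast
  have "Zero C X Y \<boxplus> g = g" using G.l_one[of g] assms by (simp add: hom_group_def)
  then show ?thesis using Minus_iff[OF assms Zero_in_Hom[OF X]] by metis
qed

lemma Comp_Minus_right:
  assumes "f \<in> Hom C X Y" "f' \<in> Hom C X Y" "g \<in> Hom C Y Z"
  shows "g \<star> (f \<boxminus> f') = (g \<star> f) \<boxminus> (g \<star> f')"
proof -
  have m: "f \<boxminus> f' \<in> Hom C X Y" using Minus_in_Hom[OF assms(1,2)] .
  have "(f \<boxminus> f') \<boxplus> f' = f" using Minus_iff[OF assms(1,2) m] by simp
  then have "(g \<star> (f \<boxminus> f')) \<boxplus> (g \<star> f') = g \<star> f"
    using Comp_Plus_right[OF m assms(2,3)] by simp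
  then show ?thesis
    using Minus_iff[OF Comp_in_Hom[OF assms(1,3)] Comp_in_Hom[OF assms(2,3)] Comp_in_Hom[OF m assms(3)]]
    by simp
qed

lemma Comp_Minus_left:
  assumes "f \<in> Hom C X Y" "g \<in> Hom C Y Z" "g' \<in> Hom C Y Z"
  shows "(g \<boxminus> g') \<star> f = (g \<star> f) \<boxminus> (g' \<star> f)"
proof -
  have m: "g \<boxminus> g' \<in> Hom C Y Z" using Minus_in_Hom[OF assms(2,3)] .
  have "(g \<boxminus> g') \<boxplus> g' = g" using Minus_iff[OF assms(2,3) m] by simp
  then have "((g \<boxminus> g') \<star> f) \<boxplus> (g' \<star> f) = g \<star> f"
    using Comp_Plus_left[OF assms(1) m assms(3)] by simp
  then show ?thesis
    using Minus_iff[OF Comp_in_Hom[OF assms(1,2)] Comp_in_Hom[OF assms(1,3)] Comp_in_Hom[OF assms(1) m]]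
    by simp
qed

section \<open>Zero objects\<close>

lemma zero_object_Hom:
  assumes "is_zero_object C Z" "X \<in> Obj C"
  shows "f \<in> Hom C X Z \<Longrightarrow> f = Zero C X Z" "g \<in> Hom C Z X \<Longrightarrow> g = Zero C Z X"
  using assms Zero_in_Hom[of X Z] Zero_in_Hom[of Z X] unfolding is_zero_object_def by metis+

lemma zero_object_projective:
  assumes "is_zero_object C Z"
  shows "projective_obj C Z"
  unfolding projective_obj_def
proof (intro conjI allI impI)
  show Z: "Z \<in> Obj C" using assms unfolding is_zero_object_def by blast
  fix g f assume g: "is_epi C g" and f: "f \<in> Hom C Z (Cod C g)"
  have gH: "g \<in> Hom C (Dom C g) (Cod C g)" using g Arr_Hom unfolding is_epi_def by blast
  have "g \<star> Zero C Z (Dom C g) = f"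
    using Comp_Zero_right[OF gH Z] zero_object_Hom(2)[OF assms HomD(5)[OF gH] f] by simp
  then show "\<exists>h \<in> Hom C Z (Dom C g). g \<star> h = f" using Zero_in_Hom[OF Z HomD(4)[OF gH]] by blast
qed

lemma zero_object_injective: "is_zero_object C Z \<Longrightarrow> injective_obj C Z"
  using preadditive_category.zero_object_projective[OF op_preadditive, of Z] by simp

section \<open>Kernels, cokernels and splittings\<close>

lemma is_kernel_iff:
  assumes "f \<in> Hom C X Y" "k \<in> Hom C K X"
  shows "is_kernel C f k \<longleftrightarrow> f \<star> k = Zero C K Y \<and>
    (\<forall>W. \<forall>g \<in> Hom C W X. f \<star> g = Zero C W Y \<longrightarrow> (\<exists>!h. h \<in> Hom C W K \<and> k \<star> h = g))"
  unfolding is_kernel_def using HomD[OF assms(1)] HomD[OF assms(2)] HomD(4) by metis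

lemma is_kernelD:
  assumes "is_kernel C f k"
  shows "f \<in> Hom C (Dom C f) (Cod C f)" "k \<in> Hom C (Dom C k) (Dom C f)"
    "f \<star> k = Zero C (Dom C k) (Cod C f)" "Cod C k = Dom C f"
  using assms unfolding is_kernel_def Hom_def by auto

lemma kernel_factor:
  assumes "is_kernel C f k" "f \<in> Hom C X Y" "k \<in> Hom C K X" "g \<in> Hom C W X"
    "f \<star> g = Zero C W Y"
  obtains h where "h \<in> Hom C W K" "k \<star> h = g"
  using assms is_kernel_iff[OF assms(2,3)] by metis

lemma kernel_mono:
  assumes "is_kernel C f k"
  shows "is_mono C k"
proof -
  note k = is_kernelD[OF assms]
  show ?thesis unfolding mono_iff[OF k(2)]
  proof (intro allI ballI impI)
    fix W g h assume g: "g \<in> Hom C W (Dom C k)" and h: "h \<in> Hom C W (Dom C k)"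
      and eq: "k \<star> g = k \<star> h"
    have "f \<star> (k \<star> g) = Zero C W (Cod C f)"
      using Comp_assoc[OF g k(2,1)] k(3) Comp_Zero_left[OF g HomD(5)[OF k(1)]] by simp
    then show "g = h"
      using is_kernel_iff[OF k(1,2)] assms Comp_in_Hom[OF g k(2)] g h eq by metis
  qed
qed

text \<open>Uniqueness of the factorization comes from \<open>k\<close> being monic, so only its
  existence has to be checked.\<close>

lemma is_kernelI:
  assumes "f \<in> Hom C X Y" "k \<in> Hom C K X" "is_mono C k" "f \<star> k = Zero C K Y"
    and "\<And>W g. g \<in> Hom C W X \<Longrightarrow> f \<star> g = Zero C W Y \<Longrightarrow> \<exists>h \<in> Hom C W K. k \<star> h = g"
  shows "is_kernel C f k"
  unfolding is_kernel_iff[OF assms(1,2)]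
proof (intro conjI allI ballI impI)
  show "f \<star> k = Zero C K Y" by fact
  fix W g assume "g \<in> Hom C W X" "f \<star> g = Zero C W Y"
  from assms(5)[OF this] obtain h where "h \<in> Hom C W K" "k \<star> h = g" by blast
  then show "\<exists>!h. h \<in> Hom C W K \<and> k \<star> h = g"
    using mono_cancel[OF assms(3,2)] by blast
qed

lemma is_cokernelD:
  assumes "is_cokernel C f c"
  shows "f \<in> Hom C (Dom C f) (Cod C f)" "c \<in> Hom C (Cod C f) (Cod C c)"
    "c \<star> f = Zero C (Dom C f) (Cod C c)" "Dom C c = Cod C f"
  using assms unfolding is_cokernel_def Hom_def by auto

lemma cokernel_factor:
  assumes "is_cokernel C f c" "f \<in> Hom C X Y" "c \<in> Hom C Y Z" "g \<in> Hom C Y W"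
    "g \<star> f = Zero C X W"
  obtains h where "h \<in> Hom C Z W" "h \<star> c = g"
  using preadditive_category.kernel_factor[OF op_preadditive, of f c Y X Z g W] assms by auto

lemma cokernel_epi: "is_cokernel C f c \<Longrightarrow> is_epi C c"
  using preadditive_category.kernel_mono[OF op_preadditive, of f c] by simp

lemma is_cokernelI:
  assumes "f \<in> Hom C X Y" "c \<in> Hom C Y Z" "is_epi C c" "c \<star> f = Zero C X Z"
    and "\<And>W g. g \<in> Hom C Y W \<Longrightarrow> g \<star> f = Zero C X W \<Longrightarrow> \<exists>h \<in> Hom C Z W. h \<star> c = g"
  shows "is_cokernel C f c"
  using preadditive_category.is_kernelI[OF op_preadditive, of f Y X c Z] assms by simp

lemma mono_comp_Zero:
  assumes "is_mono C m" "m \<in> Hom C Y Z" "g \<in> Hom C X Y" "m \<star> g = Zero C X Z"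
  shows "g = Zero C X Y"
proof -
  have "X \<in> Obj C" "Y \<in> Obj C" using HomD[OF assms(3)] by auto
  then show ?thesis
    using mono_cancel[OF assms(1-3) Zero_in_Hom] assms(4) Comp_Zero_right[OF assms(2)] by simp
qed

lemma epi_comp_Zero:
  assumes "is_epi C m" "m \<in> Hom C X Y" "g \<in> Hom C Y Z" "g \<star> m = Zero C X Z"
  shows "g = Zero C Y Z"
  using preadditive_category.mono_comp_Zero[OF op_preadditive, of m Y X g Z] assms by simp

text \<open>A monomorphism reflects zero arrows, so \<open>f\<close> and \<open>m \<star> f\<close>
  kill the same arrows.\<close>

lemma kernel_mono_comp:
  assumes "f \<in> Hom C X Y" "m \<in> Hom C Y Z" "is_mono C m"
  shows "is_kernel C (m \<star> f) k \<longleftrightarrow> is_kernel C f k"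
proof -
  have mf: "m \<star> f \<in> Hom C X Z" using Comp_in_Hom[OF assms(1,2)] .
  have Z: "m \<star> f \<star> g = Zero C W Z \<longleftrightarrow> f \<star> g = Zero C W Y" if g: "g \<in> Hom C W X" for g W
    using mono_comp_Zero[OF assms(3,2) Comp_in_Hom[OF g assms(1)]]
      Comp_Zero_right[OF assms(2) HomD(4)[OF g]] Comp_assoc[OF g assms(1,2)] by auto
  show ?thesis
  proof (cases "k \<in> Hom C (Dom C k) X")
    case True
    have "(\<forall>W. \<forall>g \<in> Hom C W X. m \<star> f \<star> g = Zero C W Z \<longrightarrow> (\<exists>!h. h \<in> Hom C W (Dom C k) \<and> k \<star> h = g)) \<longleftrightarrow>
      (\<forall>W. \<forall>g \<in> Hom C W X. f \<star> g = Zero C W Y \<longrightarrow> (\<exists>!h. h \<in> Hom C W (Dom C k) \<and> k \<star> h = g))"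
      by (intro all_cong1 ball_cong refl) (simp add: Z)
    then show ?thesis
      unfolding is_kernel_iff[OF assms(1) True] is_kernel_iff[OF mf True] using Z[OF True] by simp
  next
    \<comment> \<open>An arrow that does not end in \<open>X\<close> is a kernel of neither.\<close>
    case False
    then show ?thesis
      using is_kernelD(2)[of "m \<star> f" k] is_kernelD(2)[of f k] HomD(2)[OF mf] HomD(2)[OF assms(1)] by auto
  qed
qed

text \<open>The complementary idempotent \<open>Ident C I \<boxminus> (s \<star> c)\<close> is
  killed by \<open>c\<close>, hence factors through \<open>j\<close>; the factor \<open>u\<close> is
  the retraction.\<close>

lemma split_kernel:
  assumes "is_kernel C c j" "c \<in> Hom C I Z" "j \<in> Hom C Y I" "s \<in> Hom C Z I" "c \<star> s = Ident C Z"
  obtains u where "u \<in> Hom C I Y" "u \<star> j = Ident C Y"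
proof -
  have I: "I \<in> Obj C" "Y \<in> Obj C" "Z \<in> Obj C" using HomD[OF assms(3)] HomD[OF assms(2)] by auto
  have id: "Ident C I \<in> Hom C I I" using Ident_in_Hom[OF I(1)] .
  have sc: "s \<star> c \<in> Hom C I I" using Comp_in_Hom[OF assms(2,4)] .
  let ?d = "Ident C I \<boxminus> (s \<star> c)"
  have d: "?d \<in> Hom C I I" using Minus_in_Hom[OF id sc] .
  have "c \<star> (s \<star> c) = c"
    using Comp_assoc[OF assms(2,4,2)] assms(5) Comp_Ident_left[OF assms(2)] by simp
  then have "c \<star> ?d = Zero C I Z"
    using Comp_Minus_right[OF id sc assms(2)] Comp_Ident_right[OF assms(2)]
      Minus_eq_Zero_iff[OF assms(2,2)] by simp
  then obtain u where u: "u \<in> Hom C I Y" "j \<star> u = ?d"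
    using kernel_factor[OF assms(1-3) d] by blast
  have cj: "c \<star> j = Zero C Y Z"
    using is_kernelD(3)[OF assms(1)] HomD(2)[OF assms(3)] HomD(3)[OF assms(2)] by simp
  have "s \<star> c \<star> j = Zero C Y I"
    using Comp_assoc[OF assms(3,2,4)] cj Comp_Zero_right[OF assms(4) I(2)] by simp
  then have "?d \<star> j = j"
    using Comp_Minus_left[OF assms(3) id sc] Comp_Ident_left[OF assms(3)] Minus_Zero[OF assms(3)] by simp
  then have "j \<star> (u \<star> j) = j \<star> Ident C Y"
    using u Comp_assoc[OF assms(3) u(1) assms(3)] Comp_Ident_right[OF assms(3)] by simp
  then have "u \<star> j = Ident C Y"
    using mono_cancel[OF kernel_mono[OF assms(1)] assms(3) Comp_in_Hom[OF assms(3) u(1)] Ident_in_Hom[OF I(2)]]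
    by simp
  then show ?thesis using that u(1) by blast
qed

lemma split_cokernel:
  assumes "is_cokernel C m f" "m \<in> Hom C K P" "f \<in> Hom C P X" "g \<in> Hom C P K" "g \<star> m = Ident C K"
  obtains u where "u \<in> Hom C X P" "f \<star> u = Ident C X"
  using preadditive_category.split_kernel[OF op_preadditive, of m f P K X g] assms by auto

end


section \<open>Abelian categories\<close>

context abelian_category
begin

section \<open>Normal monomorphisms and self-duality\<close>

lemma op_abelian: "abelian_category (op_cat C)"
proof (intro abelian_category.intro op_preadditive abelian_category_axioms.intro)
  fix X Y assume "X \<in> Obj (op_cat C)" "Y \<in> Obj (op_cat C)"
  then obtain S a b c d where "is_biproduct C X Y S a b c d" using ex_biproduct by fastforce
  \<comment> \<open>Injections and projections exchange roles.\<close>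
  then have "is_biproduct (op_cat C) X Y S c d a b" unfolding is_biproduct_def by simp
  then show "\<exists>S a b c d. is_biproduct (op_cat C) X Y S a b c d" by blast
qed (auto simp: ex_zero_object ex_kernel ex_cokernel mono_normal epi_conormal)

text \<open>Normality makes \<open>k\<close> the kernel of some \<open>g\<close>. As
  \<open>g\<close> factors through the cokernel \<open>c\<close>, whatever \<open>c\<close> kills is
  killed by \<open>g\<close> and so factors through \<open>k\<close>.\<close>

lemma mono_kernel_of_cokernel:
  assumes "is_mono C k" "is_cokernel C k c"
  shows "is_kernel C c k"
proof -
  note c = is_cokernelD[OF assms(2)]
  obtain g where g: "is_kernel C g k" using mono_normal[OF assms(1)] by blast
  note g' = is_kernelD[OF g]
  have gH: "g \<in> Hom C (Cod C k) (Cod C g)" using g' by simp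
  obtain h where h: "h \<in> Hom C (Cod C c) (Cod C g)" "h \<star> c = g"
    using cokernel_factor[OF assms(2) c(1,2) gH g'(3)] .
  show ?thesis
  proof (rule is_kernelI[OF c(2,1) assms(1) c(3)])
    fix W a assume a: "a \<in> Hom C W (Cod C k)" "c \<star> a = Zero C W (Cod C c)"
    have "g \<star> a = Zero C W (Cod C g)"
      using Comp_assoc[OF a(1) c(2) h(1)] h(2) a(2) Comp_Zero_right[OF h(1) HomD(4)[OF a(1)]] by simp
    then show "\<exists>b \<in> Hom C W (Dom C k). k \<star> b = a"
      using kernel_factor[OF g gH c(1) a(1)] by blast
  qed
qed

lemma epi_cokernel_of_kernel:
  assumes "is_epi C f" "is_kernel C f k"
  shows "is_cokernel C k f"
  using abelian_category.mono_kernel_of_cokernel[OF op_abelian, of f k] assms by simp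

text \<open>Exactness is defined asymmetrically, by comparing an image with a kernel. Its dual form
  needs the cokernel \<open>c\<close> of \<open>f\<close> to be a cokernel of the image
  \<open>m\<close> as well.\<close>

lemma exact_pair_op_cat [simp]: "exact_pair (op_cat C) g f \<longleftrightarrow> exact_pair C f g"
proof -
  have half: "exact_pair (op_cat D) g f" if pre: "preadditive_category D" and fg: "exact_pair D f g"
    for D :: "('a, 'b) cat" and f g
  proof -
    interpret D: preadditive_category D by (rule pre)
    obtain c m where c: "is_cokernel D f c" and m: "is_kernel D c m" and g: "is_kernel D g m"
      using fg unfolding exact_pair_def is_image_def by blast
    note c' = D.is_cokernelD[OF c] and m' = D.is_kernelD[OF m]
    have cm: "c \<in> Hom D (Cod D m) (Cod D c)" and mH: "m \<in> Hom D (Dom D m) (Cod D m)"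
      and mf: "m \<in> Hom D (Dom D m) (Cod D f)"
      using c' m' by simp_all
    obtain u where u: "u \<in> Hom D (Dom D f) (Dom D m)" "m \<star>\<^bsub>D\<^esub> u = f"
      using D.kernel_factor[OF m c'(2) mf c'(1,3)] by blast
    \<comment> \<open>Since \<open>f\<close> factors through \<open>m\<close>, an arrow that kills
      \<open>m\<close> kills \<open>f\<close>.\<close>
    have "is_cokernel D m c"
    proof (rule D.is_cokernelI[OF mH cm D.cokernel_epi[OF c]])
      show "c \<star>\<^bsub>D\<^esub> m = Zero D (Dom D m) (Cod D c)" using m'(3) .
      fix W h assume h: "h \<in> Hom D (Cod D m) W" "h \<star>\<^bsub>D\<^esub> m = Zero D (Dom D m) W"
      have hf: "h \<in> Hom D (Cod D f) W" using h(1) m'(4) c'(4) by simp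
      have "h \<star>\<^bsub>D\<^esub> f = Zero D (Dom D f) W"
        using D.Comp_assoc[OF u(1) mH h(1)] u(2) h(2) D.Comp_Zero_left[OF u(1) D.HomD(5)[OF h(1)]]
        by simp
      then show "\<exists>b \<in> Hom D (Cod D c) W. b \<star>\<^bsub>D\<^esub> c = h"
        using D.cokernel_factor[OF c c'(1,2) hf] by blast
    qed
    then show ?thesis using c g unfolding exact_pair_def is_image_def by auto
  qed
  \<comment> \<open>The converse is the first implication applied in the opposite category.\<close>
  have "op_cat (op_cat C) = C" by (simp add: op_cat_def)
  then show ?thesis
    using half[OF op_preadditive, of g f] half[OF preadditive_category_axioms, of f g] by auto
qed

lemma injective_resolution_op_cat:
  "injective_resolution C X d \<longleftrightarrow> projective_resolution (op_cat C) X d"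
  by (simp add: injective_resolution_def projective_resolution_def)

lemma inj_dim_op_cat: "inj_dim C X = proj_dim (op_cat C) X"
  by (simp add: inj_dim_def proj_dim_def injective_resolution_op_cat)

section \<open>Factorization of an arrow through its image\<close>

lemma is_image_comp:
  assumes "is_epi C u" "is_mono C m" "u \<in> Hom C X K" "m \<in> Hom C K Y"
  shows "is_image C (m \<star> u) m"
proof -
  obtain c where c: "is_cokernel C m c" using ex_cokernel HomD(1)[OF assms(4)] by blast
  have cH: "c \<in> Hom C Y (Cod C c)" "c \<star> m = Zero C K (Cod C c)"
    using is_cokernelD[OF c] HomD[OF assms(4)] by simp_all
  note mu = Comp_in_Hom[OF assms(3,4)]
  \<comment> \<open>Because \<open>u\<close> is epi, \<open>m \<star> u\<close> and \<open>m\<close>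
    have the same cokernel, and the monomorphism \<open>m\<close> is the kernel of it.\<close>
  have "is_cokernel C (m \<star> u) c"
  proof (rule is_cokernelI[OF mu cH(1) cokernel_epi[OF c]])
    show "c \<star> (m \<star> u) = Zero C X (Cod C c)"
      using Comp_assoc[OF assms(3,4) cH(1)] cH Comp_Zero_left[OF assms(3) HomD(5)[OF cH(1)]] by simp
    fix W g assume g: "g \<in> Hom C Y W" "g \<star> (m \<star> u) = Zero C X W"
    have "g \<star> m = Zero C K W"
      using epi_comp_Zero[OF assms(1,3) Comp_in_Hom[OF assms(4) g(1)]]
        Comp_assoc[OF assms(3,4) g(1)] g(2) by simp
    then show "\<exists>h \<in> Hom C (Cod C c) W. h \<star> c = g"
      using cokernel_factor[OF c assms(4) cH(1) g(1)] by blast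
  qed
  then show ?thesis using mono_kernel_of_cokernel[OF assms(2) c] unfolding is_image_def by blast
qed

lemma is_image_factor:
  assumes "is_image C f m" "f \<in> Hom C X Y"
  obtains u where "is_mono C m" "m \<in> Hom C (Dom C m) Y" "u \<in> Hom C X (Dom C m)"
    "is_epi C u" "m \<star> u = f"
proof -
  obtain c where c: "is_cokernel C f c" and m: "is_kernel C c m"
    using assms(1) unfolding is_image_def by blast
  let ?K = "Dom C m"
  have f: "Dom C f = X" "Cod C f = Y" using HomD[OF assms(2)] by auto
  have cH: "c \<in> Hom C Y (Cod C c)" "c \<star> f = Zero C X (Cod C c)" "Dom C c = Y"
    using is_cokernelD[OF c] f by simp_all
  have mH: "m \<in> Hom C ?K Y" "c \<star> m = Zero C ?K (Cod C c)" using is_kernelD[OF m] cH by simp_all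
  have mono: "is_mono C m" using kernel_mono[OF m] .
  obtain u where u: "u \<in> Hom C X ?K" "m \<star> u = f" using kernel_factor[OF m cH(1) mH(1) assms(2) cH(2)] .
  have zero: "h = Zero C ?K W" if h: "h \<in> Hom C ?K W" and hu: "h \<star> u = Zero C X W" for h W
  proof -
    \<comment> \<open>\<open>f\<close> factors through the subobject \<open>ker h\<close> of its image, which is therefore the whole image.\<close>
    obtain k where k: "is_kernel C h k" using ex_kernel HomD(1)[OF h] by blast
    let ?U = "Dom C k"
    have kH: "k \<in> Hom C ?U ?K" "h \<star> k = Zero C ?U W" using is_kernelD[OF k] HomD[OF h] by simp_all
    obtain v where v: "v \<in> Hom C X ?U" "k \<star> v = u" using kernel_factor[OF k h kH(1) u(1) hu] .
    have mk: "m \<star> k \<in> Hom C ?U Y" "is_mono C (m \<star> k)"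
      using Comp_in_Hom[OF kH(1) mH(1)] mono_comp[OF kernel_mono[OF k] mono kH(1) mH(1)] by auto
    obtain w where w: "is_cokernel C (m \<star> k) w" using ex_cokernel HomD(1)[OF mk(1)] by blast
    have wH: "w \<in> Hom C Y (Cod C w)" "w \<star> (m \<star> k) = Zero C ?U (Cod C w)"
      using is_cokernelD[OF w] HomD[OF mk(1)] by simp_all
    have "w \<star> f = w \<star> (m \<star> k) \<star> v"
      using Comp_assoc[OF v(1) mk(1) wH(1)] Comp_assoc[OF v(1) kH(1) mH(1)] v(2) u(2) by simp
    then have "w \<star> f = Zero C X (Cod C w)"
      using wH Comp_Zero_left[OF v(1) HomD(5)[OF wH(1)]] by simp
    then obtain w' where w': "w' \<in> Hom C (Cod C c) (Cod C w)" "w' \<star> c = w"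
      using cokernel_factor[OF c assms(2) cH(1) wH(1)] by blast
    have "w \<star> m = Zero C ?K (Cod C w)"
      using Comp_assoc[OF mH(1) cH(1) w'(1)] w'(2) mH(2) Comp_Zero_right[OF w'(1) HomD(4)[OF mH(1)]]
      by simp
    \<comment> \<open>The monomorphism \<open>m \<star> k\<close> is the kernel of its cokernel
      \<open>w\<close>, and \<open>w\<close> kills \<open>m\<close>. The resulting \<open>x\<close>
      is a right inverse of \<open>k\<close>, so \<open>h \<star> k = 0\<close> forces
      \<open>h = 0\<close>.\<close>
    then obtain x where x: "x \<in> Hom C ?K ?U" "m \<star> k \<star> x = m"
      using kernel_factor[OF mono_kernel_of_cokernel[OF mk(2) w] wH(1) mk(1) mH(1)] by blast
    have K: "?K \<in> Obj C" using HomD(4)[OF mH(1)] .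
    have "m \<star> (k \<star> x) = m \<star> Ident C ?K"
      using x(2) Comp_assoc[OF x(1) kH(1) mH(1)] Comp_Ident_right[OF mH(1)] by simp
    then have "k \<star> x = Ident C ?K"
      using mono_cancel[OF mono mH(1) Comp_in_Hom[OF x(1) kH(1)] Ident_in_Hom[OF K]] by blast
    then have "h = h \<star> k \<star> x" using Comp_assoc[OF x(1) kH(1) h] Comp_Ident_right[OF h] by simp
    then show ?thesis using kH(2) Comp_Zero_left[OF x(1) HomD(5)[OF h]] by simp
  qed
  \<comment> \<open>With additive hom sets, cancellation reduces to the case of zero, applied to the
    difference of the two arrows.\<close>
  have "is_epi C u" unfolding epi_iff[OF u(1)]
  proof (intro allI ballI impI)
    fix W a b assume a: "a \<in> Hom C ?K W" and b: "b \<in> Hom C ?K W" and eq: "a \<star> u = b \<star> u"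
    have "(a \<boxminus> b) \<star> u = Zero C X W"
      using Comp_Minus_left[OF u(1) a b] Minus_eq_Zero_iff[OF Comp_in_Hom[OF u(1) a] Comp_in_Hom[OF u(1) b]] eq
      by simp
    then show "a = b" using zero[OF Minus_in_Hom[OF a b]] Minus_eq_Zero_iff[OF a b] by blast
  qed
  then show ?thesis using that mono mH(1) u by blast
qed

section \<open>Working with exact pairs\<close>

lemma exact_pairD:
  assumes "exact_pair C a b"
  shows "a \<in> Hom C (Dom C a) (Dom C b)" "b \<in> Hom C (Dom C b) (Cod C b)" "Cod C a = Dom C b"
    "b \<star> a = Zero C (Dom C a) (Cod C b)"
proof -
  obtain c m where c: "is_cokernel C a c" and m: "is_kernel C c m" and b: "is_kernel C b m"
    using assms unfolding exact_pair_def is_image_def by blast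
  show ab: "Cod C a = Dom C b"
    using is_cokernelD(4)[OF c] is_kernelD(4)[OF m] is_kernelD(4)[OF b] by simp
  then show aH: "a \<in> Hom C (Dom C a) (Dom C b)" and bH: "b \<in> Hom C (Dom C b) (Cod C b)"
    using is_cokernelD(1)[OF c] is_kernelD(1)[OF b] by simp_all
  have im: "is_image C a m" using c m unfolding is_image_def by blast
  obtain u where u: "m \<in> Hom C (Dom C m) (Dom C b)" "u \<in> Hom C (Dom C a) (Dom C m)" "m \<star> u = a"
    using is_image_factor[OF im aH] by blast
  show "b \<star> a = Zero C (Dom C a) (Cod C b)"
    using Comp_assoc[OF u(2,1) bH] u(3) is_kernelD(3)[OF b]
      Comp_Zero_left[OF u(2) HomD(5)[OF bH]] by simp
qed

text \<open>The usable form of exactness: the first map is an epimorphism onto the kernel of the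
  second.\<close>

lemma exact_pair_factor:
  assumes "exact_pair C a b"
  obtains m u where "is_kernel C b m" "m \<in> Hom C (Dom C m) (Dom C b)" "is_epi C u"
    "u \<in> Hom C (Dom C a) (Dom C m)" "m \<star> u = a"
proof -
  obtain m where m: "is_image C a m" "is_kernel C b m" using assms unfolding exact_pair_def by blast
  show ?thesis using is_image_factor[OF m(1) exact_pairD(1)[OF assms]] that m(2) by blast
qed

lemma exact_pair_comp_epi:
  assumes "is_kernel C b m" "is_epi C u" "u \<in> Hom C X (Dom C m)"
  shows "exact_pair C (m \<star> u) b"
  using is_image_comp[OF assms(2) kernel_mono[OF assms(1)] assms(3) is_kernelD(2)[OF assms(1)]] assms(1)
  unfolding exact_pair_def by blast

lemma exact_pair_mono_comp:
  assumes "is_mono C m" "m \<in> Hom C Y Z" "b \<in> Hom C X Y"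
  shows "exact_pair C a (m \<star> b) \<longleftrightarrow> exact_pair C a b"
  unfolding exact_pair_def using kernel_mono_comp[OF assms(3,2,1)] by simp

text \<open>The epimorphism \<open>b\<close> is the cokernel of its kernel \<open>m\<close>, and
  \<open>a = m \<star> u\<close> with \<open>u\<close> epi is killed by the same arrows as
  \<open>m\<close>.\<close>

lemma exact_pair_epi_cokernel:
  assumes "exact_pair C a b" "is_epi C b"
  shows "is_cokernel C a b"
proof -
  note ab = exact_pairD[OF assms(1)]
  obtain m u where m: "is_kernel C b m" "m \<in> Hom C (Dom C m) (Dom C b)" "is_epi C u"
    "u \<in> Hom C (Dom C a) (Dom C m)" "m \<star> u = a" using exact_pair_factor[OF assms(1)] .
  have coker: "is_cokernel C m b" using epi_cokernel_of_kernel[OF assms(2) m(1)] .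
  show ?thesis
  proof (rule is_cokernelI[OF ab(1,2) assms(2) ab(4)])
    fix W g assume g: "g \<in> Hom C (Dom C b) W" "g \<star> a = Zero C (Dom C a) W"
    have "g \<star> m = Zero C (Dom C m) W"
      using epi_comp_Zero[OF m(3,4) Comp_in_Hom[OF m(2) g(1)]] Comp_assoc[OF m(4,2) g(1)] m(5) g(2)
      by simp
    then show "\<exists>h \<in> Hom C (Cod C b) W. h \<star> b = g"
      using cokernel_factor[OF coker m(2) ab(2) g(1)] by blast
  qed
qed

text \<open>First factor \<open>f\<close> through the kernel of \<open>b\<close>, then lift along
  the epimorphism onto that kernel.\<close>

lemma exact_projective_lift:
  assumes "exact_pair C a b" "projective_obj C P" "f \<in> Hom C P (Dom C b)"
    "b \<star> f = Zero C P (Cod C b)"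
  obtains w where "w \<in> Hom C P (Dom C a)" "a \<star> w = f"
proof -
  obtain m u where m: "is_kernel C b m" "m \<in> Hom C (Dom C m) (Dom C b)" "is_epi C u"
    "u \<in> Hom C (Dom C a) (Dom C m)" "m \<star> u = a" using exact_pair_factor[OF assms(1)] .
  obtain g where g: "g \<in> Hom C P (Dom C m)" "m \<star> g = f"
    using kernel_factor[OF m(1) exact_pairD(2)[OF assms(1)] m(2) assms(3,4)] .
  obtain w where w: "w \<in> Hom C P (Dom C a)" "u \<star> w = g" using projective_lift[OF assms(2) m(3,4) g(1)] .
  have "a \<star> w = f" using Comp_assoc[OF w(1) m(4,2)] w(2) g(2) m(5) by simp
  then show ?thesis using that w(1) by blast
qed

lemma exact_injective_extend:
  assumes "exact_pair C a b" "injective_obj C I" "f \<in> Hom C (Dom C b) I"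
    "f \<star> a = Zero C (Dom C a) I"
  obtains w where "w \<in> Hom C (Cod C b) I" "w \<star> b = f"
  using abelian_category.exact_projective_lift[OF op_abelian, of b a I f] assms
    exact_pairD(3)[OF assms(1)] by auto

text \<open>Supplies exactness in a resolution that is continued by zero objects.\<close>

lemma exact_pair_Zero_mono:
  assumes "is_zero_object C Z" "is_mono C m" "m \<in> Hom C X Y"
  shows "exact_pair C (Zero C Z X) m"
proof -
  have Z: "Z \<in> Obj C" and X: "X \<in> Obj C" and Y: "Y \<in> Obj C"
    using assms(1) HomD[OF assms(3)] unfolding is_zero_object_def by auto
  have zH: "Zero C Z X \<in> Hom C Z X" using Zero_in_Hom[OF Z X] .
  have zm: "is_mono C (Zero C Z X)"
    unfolding mono_iff[OF zH] using zero_object_Hom(1)[OF assms(1)] HomD(4) by metis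
  have ker: "is_kernel C g (Zero C Z X)" if g: "g \<in> Hom C X V" "is_mono C g" for g V
  proof (rule is_kernelI[OF g(1) zH zm Comp_Zero_right[OF g(1) Z]])
    fix W h assume h: "h \<in> Hom C W X" "g \<star> h = Zero C W V"
    have W: "W \<in> Obj C" using HomD[OF h(1)] by blast
    have "h = Zero C W X" using mono_comp_Zero[OF g(2,1) h] .
    then have "Zero C Z X \<star> Zero C W Z = h" using Comp_Zero_right[OF zH W] by simp
    then show "\<exists>k \<in> Hom C W Z. Zero C Z X \<star> k = h" using Zero_in_Hom[OF W Z] by blast
  qed
  have "is_cokernel C (Zero C Z X) (Ident C X)"
  proof (rule is_cokernelI[OF zH Ident_in_Hom[OF X] Ident_epi[OF X] Comp_Ident_left[OF zH]])
    fix W g assume "g \<in> Hom C X W"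
    then show "\<exists>h \<in> Hom C X W. h \<star> Ident C X = g" using Comp_Ident_right by blast
  qed
  then show ?thesis
    using ker[OF Ident_in_Hom[OF X] Ident_mono[OF X]] ker[OF assms(3,2)]
    unfolding exact_pair_def is_image_def by blast
qed

end


section \<open>Resolutions and dimensions\<close>

text \<open>A finite bound excludes the empty set, whose infimum is \<infinity>, and a nonempty set
  of extended naturals attains its infimum. Hence a finite dimension is the length of an actual
  resolution.\<close>

lemma enat_Inf_in:
  assumes "Inf S \<le> enat n"
  shows "Inf S \<in> S"
proof -
  obtain x where "x \<in> S" using assms by (cases "S = {}") (auto simp: top_enat_def)
  then show ?thesis unfolding Inf_enat_def by (auto intro: LeastI)
qed

lemma proj_dim_le_iff:
  "proj_dim C X \<le> enat n \<longleftrightarrow>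
    (\<exists>d. projective_resolution C X d \<and> (\<forall>k>n. is_zero_object C (Dom C (d k))))"
proof
  let ?S = "{enat n | n. \<exists>d. projective_resolution C X d \<and> (\<forall>k>n. is_zero_object C (Dom C (d k)))}"
  assume le: "proj_dim C X \<le> enat n"
  then have "Inf ?S \<in> ?S" unfolding proj_dim_def by (rule enat_Inf_in)
  then obtain m d where m: "proj_dim C X = enat m" "projective_resolution C X d"
    "\<forall>k>m. is_zero_object C (Dom C (d k))" unfolding proj_dim_def by blast
  \<comment> \<open>A resolution of the least length \<open>m\<close> also works for
    \<open>n\<close>, since \<open>m \<le> n\<close>.\<close>
  then show "\<exists>d. projective_resolution C X d \<and> (\<forall>k>n. is_zero_object C (Dom C (d k)))"
    using le by (intro exI[of _ d]) auto
next
  assume "\<exists>d. projective_resolution C X d \<and> (\<forall>k>n. is_zero_object C (Dom C (d k)))"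
  then show "proj_dim C X \<le> enat n" unfolding proj_dim_def by (intro Inf_lower) blast
qed

context abelian_category
begin

section \<open>Existence and shifting of projective resolutions\<close>

lemma resolutionD:
  assumes "projective_resolution C X d"
  shows "is_epi C (d 0)" "d 0 \<in> Hom C (Dom C (d 0)) X" "exact_pair C (d (Suc n)) (d n)"
    "projective_obj C (Dom C (d n))" "Dom C (d n) \<in> Obj C" "Cod C (d (Suc n)) = Dom C (d n)"
    "d (Suc n) \<in> Hom C (Dom C (d (Suc n))) (Dom C (d n))"
    "d n \<star> d (Suc n) = Zero C (Dom C (d (Suc n))) (Cod C (d n))"
proof -
  show epi: "is_epi C (d 0)" and ex: "exact_pair C (d (Suc n)) (d n)"
    and P: "projective_obj C (Dom C (d n))"
    using assms by (auto simp: projective_resolution_def Proj_def)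
  show "d 0 \<in> Hom C (Dom C (d 0)) X"
    using assms epi Arr_Hom[of "d 0"] by (simp add: projective_resolution_def is_epi_def)
  show "Dom C (d n) \<in> Obj C" using P by (simp add: projective_obj_def)
qed (use exact_pairD[of "d (Suc n)" "d n"] assms in \<open>simp_all add: projective_resolution_def\<close>)

lemma ex_projective_resolution:
  assumes "enough_projectives C" "X \<in> Obj C"
  shows "\<exists>d. projective_resolution C X d"
proof -
  \<comment> \<open>\<open>nxt f\<close> is a projective mapping onto the kernel of
    \<open>f\<close>; the resolution iterates it from an epimorphism
    \<open>P \<rightarrow> X\<close>.\<close>
  define nxt where "nxt f = (SOME g. exact_pair C g f \<and> Dom C g \<in> Proj C)" for f
  have nxt: "exact_pair C (nxt f) f \<and> Dom C (nxt f) \<in> Proj C" if f: "f \<in> Arr C" for f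
  proof -
    obtain k where k: "is_kernel C f k" using ex_kernel f by blast
    obtain P u where u: "P \<in> Proj C" "u \<in> Hom C P (Dom C k)" "is_epi C u"
      using assms(1) HomD(4)[OF is_kernelD(2)[OF k]] unfolding enough_projectives_def by blast
    have "exact_pair C (k \<star> u) f" using exact_pair_comp_epi[OF k u(3,2)] .
    moreover have "Dom C (k \<star> u) = P"
      using HomD(2)[OF Comp_in_Hom[OF u(2) is_kernelD(2)[OF k]]] .
    ultimately have "exact_pair C (k \<star> u) f \<and> Dom C (k \<star> u) \<in> Proj C" using u(1) by simp
    then show ?thesis unfolding nxt_def by (rule someI)
  qed
  obtain P u where u: "P \<in> Proj C" "u \<in> Hom C P X" "is_epi C u"
    using assms unfolding enough_projectives_def by blast
  define d where "d n = (nxt ^^ n) u" for n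
  have d0: "d 0 = u" and dS: "d (Suc n) = nxt (d n)" for n by (simp_all add: d_def)
  have "d n \<in> Arr C \<and> Dom C (d n) \<in> Proj C" for n
  proof (induction n)
    case 0
    then show ?case using u HomD[OF u(2)] d0 by simp
  next
    case (Suc n)
    then have "exact_pair C (d (Suc n)) (d n) \<and> Dom C (d (Suc n)) \<in> Proj C" using nxt dS by simp
    then show ?case using HomD(1)[OF exact_pairD(1)] by blast
  qed
  then show ?thesis using nxt u HomD[OF u(2)] d0 dS
    by (intro exI[of _ d]) (simp add: projective_resolution_def)
qed

text \<open>The first syzygy \<open>Dom C m\<close> is resolved by the tail of \<open>d\<close>: its
  augmentation \<open>u\<close> is the epi part of \<open>d 1\<close> and has the same kernel as
  \<open>d 1\<close>, because \<open>m\<close> is monic.\<close>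

lemma resolution_shift:
  assumes "projective_resolution C X d"
  obtains m u where "is_kernel C (d 0) m" "m \<in> Hom C (Dom C m) (Dom C (d 0))"
    "u \<in> Hom C (Dom C (d 1)) (Dom C m)" "m \<star> u = d 1"
    "projective_resolution C (Dom C m) (\<lambda>n. if n = 0 then u else d (Suc n))"
proof -
  note d = resolutionD[OF assms]
  obtain m u where m: "is_kernel C (d 0) m" "m \<in> Hom C (Dom C m) (Dom C (d 0))" "is_epi C u"
    "u \<in> Hom C (Dom C (d 1)) (Dom C m)" "m \<star> u = d 1"
    using exact_pair_factor[OF d(3)[of 0]] unfolding One_nat_def by blast
  have "exact_pair C (d (Suc 1)) u"
    using exact_pair_mono_comp[OF kernel_mono[OF m(1)] m(2,4)] d(3)[of 1] m(5) by simp
  then have "projective_resolution C (Dom C m) (\<lambda>n. if n = 0 then u else d (Suc n))"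
    using m(3) HomD[OF m(4)] d(3,4) by (auto simp: projective_resolution_def Proj_def)
  then show ?thesis using that m by blast
qed

section \<open>Dimension of projectives and passage from a syzygy\<close>

lemma proj_dim_projective:
  assumes "projective_obj C X"
  shows "proj_dim C X \<le> enat 0"
proof -
  have X: "X \<in> Obj C" using assms unfolding projective_obj_def by blast
  obtain Z where Z: "is_zero_object C Z" using ex_zero_object by blast
  then have ZO: "Z \<in> Obj C" unfolding is_zero_object_def by blast
  \<comment> \<open>The identity of \<open>X\<close> augments the resolution, which is zero
    afterwards: \<open>Dom C (d n)\<close> is \<open>Z\<close> for every
    \<open>n > 0\<close>.\<close>
  define d where "d n = (if n = 0 then Ident C X else if n = 1 then Zero C Z X else Zero C Z Z)" for n :: nat
  have zm: "is_mono C (Zero C Z Y)" if "Y \<in> Obj C" for Y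
    unfolding mono_iff[OF Zero_in_Hom[OF ZO that]] using zero_object_Hom(1)[OF Z] HomD(4) by metis
  have dom: "Dom C (d n) = (if n = 0 then X else Z)" for n
    using HomD(2)[OF Ident_in_Hom[OF X]] HomD(2)[OF Zero_in_Hom[OF ZO X]] HomD(2)[OF Zero_in_Hom[OF ZO ZO]]
    by (simp add: d_def)
  have "exact_pair C (d (Suc n)) (d n)" for n
    using exact_pair_Zero_mono[OF Z Ident_mono[OF X] Ident_in_Hom[OF X]]
      exact_pair_Zero_mono[OF Z zm[OF X] Zero_in_Hom[OF ZO X]]
      exact_pair_Zero_mono[OF Z zm[OF ZO] Zero_in_Hom[OF ZO ZO]] by (simp add: d_def)
  then have "projective_resolution C X d"
    using assms zero_object_projective[OF Z] Ident_epi[OF X] HomD(3)[OF Ident_in_Hom[OF X]]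
    unfolding projective_resolution_def Proj_def dom by (simp add: d_def)
  then show ?thesis unfolding proj_dim_le_iff using dom Z by auto
qed

lemma proj_dim_syzygy:
  assumes "projective_obj C P" "is_epi C f" "f \<in> Hom C P X" "is_kernel C f m"
    "proj_dim C (Dom C m) \<le> enat n"
  shows "proj_dim C X \<le> enat (Suc n)"
proof -
  obtain d where d: "projective_resolution C (Dom C m) d" "\<forall>k>n. is_zero_object C (Dom C (d k))"
    using assms(5) unfolding proj_dim_le_iff by blast
  note d' = resolutionD[OF d(1)]
  have m: "m \<in> Hom C (Dom C m) P" using is_kernelD(2)[OF assms(4)] HomD[OF assms(3)] by simp
  have md: "m \<star> d 0 \<in> Hom C (Dom C (d 0)) P" using Comp_in_Hom[OF d'(2) m] .
  \<comment> \<open>The resolution of the syzygy is spliced onto \<open>f\<close> through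
    \<open>m\<close>. All its terms move up by one index, so the zeros start after
    \<open>Suc n\<close>.\<close>
  define d1 where "d1 k = (if k = 0 then f else if k = 1 then m \<star> d 0 else d (k - 1))" for k
  have dom: "Dom C (d1 k) = (if k = 0 then P else Dom C (d (k - 1)))" for k
    using HomD(2)[OF md] HomD(2)[OF assms(3)] by (simp add: d1_def)
  have ex: "exact_pair C (d1 (Suc k)) (d1 k)" for k
  proof (cases k)
    case 0
    then show ?thesis using exact_pair_comp_epi[OF assms(4) d'(1,2)] by (simp add: d1_def)
  next
    case (Suc j)
    show ?thesis
    proof (cases j)
      case 0
      then show ?thesis
        using Suc exact_pair_mono_comp[OF kernel_mono[OF assms(4)] m d'(2)] d'(3)[of 0]
        by (simp add: d1_def)
    qed (use Suc d'(3) in \<open>simp add: d1_def\<close>)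
  qed
  have "Dom C (d1 k) \<in> Proj C" for k using assms(1) d'(4) unfolding dom Proj_def by simp
  then have "projective_resolution C X d1"
    using ex assms(2) HomD(3)[OF assms(3)] by (simp add: projective_resolution_def d1_def)
  then show ?thesis unfolding proj_dim_le_iff using dom d(2) by (intro exI[of _ d1]) auto
qed

lemma inj_dim_injective: "injective_obj C X \<Longrightarrow> inj_dim C X \<le> enat 0"
  using abelian_category.proj_dim_projective[OF op_abelian, of X] by (simp add: inj_dim_op_cat)

lemma inj_dim_cosyzygy:
  assumes "injective_obj C I" "is_mono C f" "f \<in> Hom C Y I" "is_cokernel C f c"
    "inj_dim C (Cod C c) \<le> enat n"
  shows "inj_dim C Y \<le> enat (Suc n)"
  using abelian_category.proj_dim_syzygy[OF op_abelian, of I f Y c n] assms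
  by (simp add: inj_dim_op_cat)

end


section \<open>Vanishing of extension groups\<close>

definition ext_vanishes :: "('o, 'm) cat \<Rightarrow> (nat \<Rightarrow> 'm) \<Rightarrow> nat \<Rightarrow> 'o \<Rightarrow> bool" where
  "ext_vanishes C d n Y \<longleftrightarrow> ext_cocycles C d n Y \<subseteq> ext_coboundaries C d n Y"

lemma ext_vanishes_Suc:
  "ext_vanishes C d (Suc n) Y \<longleftrightarrow>
    (\<forall>f \<in> Hom C (Dom C (d (Suc n))) Y. f \<star>\<^bsub>C\<^esub> d (Suc (Suc n)) = Zero C (Dom C (d (Suc (Suc n)))) Y \<longrightarrow>
       (\<exists>w \<in> Hom C (Dom C (d n)) Y. w \<star>\<^bsub>C\<^esub> d (Suc n) = f))"
  by (auto simp: ext_vanishes_def ext_cocycles_def ext_coboundaries_def)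

text \<open>If there is one coset only, then \<open>H #> x\<close> equals \<open>H\<close> and
  contains \<open>x\<close>. Cardinality 1 characterizes the trivial quotient and, unlike the
  inclusion of cocycles in coboundaries, is visibly invariant under isomorphism.\<close>

lemma (in group) card_FactGroup_eq_1_iff:
  assumes "H \<subseteq> carrier G" "\<one> \<in> H"
  shows "card (carrier (G Mod H)) = 1 \<longleftrightarrow> H = carrier G"
proof
  assume "card (carrier (G Mod H)) = 1"
  then have "card (rcosets H) = 1" by (simp add: FactGroup_def)
  then obtain c where c: "rcosets H = {c}" by (rule card_1_singletonE)
  have "x \<in> H" if x: "x \<in> carrier G" for x
  proof -
    have "H #> x = H #> \<one>"
      using rcosetsI[OF assms(1) x] rcosetsI[OF assms(1) one_closed] unfolding c by simp
    moreover have "\<one> \<otimes> x \<in> H #> x" using assms(2) unfolding r_coset_def by blast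
    ultimately show ?thesis using coset_mult_one[OF assms(1)] x by simp
  qed
  then show "H = carrier G" using assms(1) by blast
next
  assume H: "H = carrier G"
  have "H #> x = H" if "x \<in> carrier G" for x
    using coset_join2[OF that _] subgroup_self that H by simp
  then have "rcosets H = {H}" using one_closed unfolding RCOSETS_def by auto
  then show "card (carrier (G Mod H)) = 1" by (simp add: FactGroup_def)
qed

context abelian_category
begin

lemma ext_vanishes_iff_card:
  assumes "projective_resolution C X d" "Y \<in> Obj C"
  shows "ext_vanishes C d (Suc n) Y \<longleftrightarrow> card (carrier (ext_via C d (Suc n) Y)) = 1"
proof -
  note d = resolutionD[OF assms(1)]
  let ?P = "\<lambda>k. Dom C (d k)"
  let ?G = "hom_group C (?P (Suc n)) Y"
  let ?H = "hom_group C (?P (Suc (Suc n))) Y"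
  let ?h = "\<lambda>f. f \<star> d (Suc (Suc n))"
  let ?Z = "ext_cocycles C d (Suc n) Y" and ?B = "ext_coboundaries C d (Suc n) Y"
  interpret G: comm_group ?G using hom_comm_group[OF d(5) assms(2)] .
  interpret H: comm_group ?H using hom_comm_group[OF d(5) assms(2)] .
  \<comment> \<open>The cocycles are the kernel of precomposition with the next differential, hence
    a group.\<close>
  interpret h: group_hom ?G ?H ?h
  proof unfold_locales
    show "?h \<in> hom ?G ?H"
      using Comp_in_Hom[OF d(7)] Comp_Plus_left[OF d(7)] unfolding hom_def hom_group_def by auto
  qed
  have "?Z = kernel ?G ?H ?h" by (simp add: ext_cocycles_def kernel_def hom_group_def)
  then have "subgroup ?Z ?G" using h.subgroup_kernel by simp
  then interpret Z: group "?G\<lparr>carrier := ?Z\<rparr>" by (rule G.subgroup_imp_group)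
  have "w \<star> d (Suc n) \<in> ?Z" if w: "w \<in> Hom C (?P n) Y" for w
  proof -
    have "w \<star> d (Suc n) \<star> d (Suc (Suc n)) = Zero C (?P (Suc (Suc n))) Y"
      using Comp_assoc[OF d(7) d(7) w] d(8)[of "Suc n"] d(6)[of n] Comp_Zero_right[OF w d(5)] by simp
    then show ?thesis using Comp_in_Hom[OF d(7) w] by (simp add: ext_cocycles_def)
  qed
  then have sub: "?B \<subseteq> ?Z" by (auto simp: ext_coboundaries_def)
  have "Zero C (?P n) Y \<star> d (Suc n) = Zero C (?P (Suc n)) Y"
    using Comp_Zero_left[OF d(7) assms(2)] .
  then have one: "\<one>\<^bsub>?G\<^esub> \<in> ?B"
    using Zero_in_Hom[OF d(5)[of n] assms(2)] by (force simp: ext_coboundaries_def hom_group_def)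
  have "card (carrier (ext_via C d (Suc n) Y)) = 1 \<longleftrightarrow> ?B = ?Z"
    unfolding ext_via_def using Z.card_FactGroup_eq_1_iff[of ?B] sub one by simp
  moreover have "?Z \<subseteq> ?B \<longleftrightarrow> ?B = ?Z" by (rule iffI, rule subset_antisym[OF sub], assumption, erule equalityD2)
  ultimately show ?thesis unfolding ext_vanishes_def by (simp only:)
qed

section \<open>Vanishing for injective second and projective first argument\<close>

lemma ext_vanishes_injective:
  assumes "projective_resolution C X d" "injective_obj C I"
  shows "ext_vanishes C d (Suc n) I"
  unfolding ext_vanishes_Suc
proof (intro ballI impI)
  note d = resolutionD[OF assms(1)]
  fix f assume f: "f \<in> Hom C (Dom C (d (Suc n))) I"
    "f \<star> d (Suc (Suc n)) = Zero C (Dom C (d (Suc (Suc n)))) I"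
  obtain w where "w \<in> Hom C (Cod C (d (Suc n))) I" "w \<star> d (Suc n) = f"
    using exact_injective_extend[OF d(3) assms(2) f] .
  then show "\<exists>w \<in> Hom C (Dom C (d n)) I. w \<star> d (Suc n) = f"
    unfolding d(6) by blast
qed

text \<open>A resolution of a projective object is split: the sections below are the
  components of a contracting homotopy.\<close>

lemma resolution_of_projective_splits:
  assumes "projective_resolution C X d" "projective_obj C X"
  shows "\<exists>s \<in> Hom C (Cod C (d n)) (Dom C (d n)). d n \<star> s \<star> d n = d n"
proof (induction n)
  case 0
  note d = resolutionD[OF assms(1)]
  have X: "X \<in> Obj C" using HomD[OF d(2)] by blast
  obtain s where s: "s \<in> Hom C X (Dom C (d 0))" "d 0 \<star> s = Ident C X"
    using projective_lift[OF assms(2) d(1,2) Ident_in_Hom[OF X]] .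
  have "d 0 \<star> s \<star> d 0 = d 0" using s(2) Comp_Ident_left[OF d(2)] by simp
  then show ?case using s(1) unfolding HomD(3)[OF d(2)] by blast
next
  case (Suc n)
  note d = resolutionD[OF assms(1)]
  let ?P = "\<lambda>k. Dom C (d k)"
  let ?i = "Ident C (?P n)"
  obtain s where s: "s \<in> Hom C (Cod C (d n)) (?P n)" "d n \<star> s \<star> d n = d n" using Suc by blast
  have dn: "d n \<in> Hom C (?P n) (Cod C (d n))" using exact_pairD(2)[OF d(3)] .
  have i: "?i \<in> Hom C (?P n) (?P n)" using Ident_in_Hom[OF d(5)] .
  have sd: "s \<star> d n \<in> Hom C (?P n) (?P n)" using Comp_in_Hom[OF dn s(1)] .
  \<comment> \<open>The part of the identity of \<open>?P n\<close> not accounted for by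
    \<open>s \<star> d n\<close> lands in the kernel of \<open>d n\<close>, so projectivity of
    \<open>?P n\<close> lifts it along \<open>d (Suc n)\<close>; the lift is the next component of
    the homotopy.\<close>
  have "d n \<star> (?i \<boxminus> (s \<star> d n)) = Zero C (?P n) (Cod C (d n))"
    using Comp_Minus_right[OF i sd dn] Comp_assoc[OF dn s(1) dn] s(2) Comp_Ident_right[OF dn]
      Minus_eq_Zero_iff[OF dn dn] by simp
  then obtain t where t: "t \<in> Hom C (?P n) (?P (Suc n))" "d (Suc n) \<star> t = ?i \<boxminus> (s \<star> d n)"
    using exact_projective_lift[OF d(3) d(4) Minus_in_Hom[OF i sd]] by blast
  have dS: "d (Suc n) \<in> Hom C (?P (Suc n)) (?P n)" using d(7) .
  have "s \<star> d n \<star> d (Suc n) = Zero C (?P (Suc n)) (?P n)"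
    using Comp_assoc[OF dS dn s(1)] d(8)[of n] Comp_Zero_right[OF s(1) d(5)] by simp
  then have "d (Suc n) \<star> t \<star> d (Suc n) = d (Suc n)"
    using t(2) Comp_Minus_left[OF dS i sd] Comp_Ident_left[OF dS] Minus_Zero[OF dS] by simp
  then show ?case using t(1) d(6)[of n] by auto
qed

text \<open>The contracting homotopy writes the identity as \<open>s \<star> d (Suc n)\<close> plus
  an arrow factoring through \<open>d (Suc (Suc n))\<close>. A cocycle \<open>f\<close> kills the
  latter, so it is the coboundary of \<open>f \<star> s\<close>.\<close>

lemma ext_vanishes_projective:
  assumes "projective_resolution C X d" "projective_obj C X"
  shows "ext_vanishes C d (Suc n) Y"
  unfolding ext_vanishes_Suc
proof (intro ballI impI)
  note d = resolutionD[OF assms(1)]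
  let ?P = "Dom C (d (Suc n))" and ?Q = "Dom C (d n)"
  let ?i = "Ident C ?P"
  fix f assume f: "f \<in> Hom C ?P Y"
    "f \<star> d (Suc (Suc n)) = Zero C (Dom C (d (Suc (Suc n)))) Y"
  have dn: "d (Suc n) \<in> Hom C ?P ?Q" using d(7) .
  obtain s where s: "s \<in> Hom C ?Q ?P" "d (Suc n) \<star> s \<star> d (Suc n) = d (Suc n)"
    using resolution_of_projective_splits[OF assms, of "Suc n"] d(6)[of n] by auto
  have i: "?i \<in> Hom C ?P ?P" using Ident_in_Hom[OF d(5)] .
  have sd: "s \<star> d (Suc n) \<in> Hom C ?P ?P" using Comp_in_Hom[OF dn s(1)] .
  have m: "?i \<boxminus> (s \<star> d (Suc n)) \<in> Hom C ?P ?P" using Minus_in_Hom[OF i sd] .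
  have "d (Suc n) \<star> (?i \<boxminus> (s \<star> d (Suc n))) = Zero C ?P (Cod C (d (Suc n)))"
    using Comp_Minus_right[OF i sd dn] Comp_assoc[OF dn s(1) dn] s(2) Comp_Ident_right[OF dn]
      Minus_eq_Zero_iff[OF dn dn] d(6)[of n] by simp
  then obtain t where t: "t \<in> Hom C ?P (Dom C (d (Suc (Suc n))))"
    "d (Suc (Suc n)) \<star> t = ?i \<boxminus> (s \<star> d (Suc n))"
    using exact_projective_lift[OF d(3) d(4) m] by blast
  have "f \<star> (?i \<boxminus> (s \<star> d (Suc n))) = Zero C ?P Y"
    using Comp_assoc[OF t(1) d(7) f(1)] t(2) f(2) Comp_Zero_left[OF t(1) HomD(5)[OF f(1)]] by simp
  then have "f \<boxminus> (f \<star> (s \<star> d (Suc n))) = Zero C ?P Y"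
    using Comp_Minus_right[OF i sd f(1)] Comp_Ident_right[OF f(1)] by simp
  then have "f = f \<star> (s \<star> d (Suc n))"
    using Minus_eq_Zero_iff[OF f(1) Comp_in_Hom[OF sd f(1)]] by simp
  then have "f \<star> s \<star> d (Suc n) = f" using Comp_assoc[OF dn s(1) f(1)] by simp
  then show "\<exists>w \<in> Hom C ?Q Y. w \<star> d (Suc n) = f" using Comp_in_Hom[OF s(1) f(1)] by blast
qed

section \<open>Transport along retracts and isomorphisms\<close>

lemma ext_vanishes_retract:
  assumes "ext_vanishes C d (Suc n) Y" "u \<in> Hom C Y Y'" "v \<in> Hom C Y' Y" "u \<star> v = Ident C Y'"
    "projective_resolution C X d"
  shows "ext_vanishes C d (Suc n) Y'"
  unfolding ext_vanishes_Suc
proof (intro ballI impI)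
  note d = resolutionD[OF assms(5)]
  fix f assume f: "f \<in> Hom C (Dom C (d (Suc n))) Y'"
    "f \<star> d (Suc (Suc n)) = Zero C (Dom C (d (Suc (Suc n)))) Y'"
  have "v \<star> f \<star> d (Suc (Suc n)) = Zero C (Dom C (d (Suc (Suc n)))) Y"
    using Comp_assoc[OF d(7) f(1) assms(3)] f(2) Comp_Zero_right[OF assms(3) d(5)] by simp
  then obtain w where w: "w \<in> Hom C (Dom C (d n)) Y" "w \<star> d (Suc n) = v \<star> f"
    using assms(1) Comp_in_Hom[OF f(1) assms(3)] unfolding ext_vanishes_Suc by blast
  have "u \<star> w \<star> d (Suc n) = f"
    using Comp_assoc[OF d(7) w(1) assms(2)] w(2) Comp_assoc[OF f(1) assms(3,2)] assms(4)
      Comp_Ident_left[OF f(1)] by simp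
  then show "\<exists>w \<in> Hom C (Dom C (d n)) Y'. w \<star> d (Suc n) = f"
    using Comp_in_Hom[OF w(1) assms(2)] by blast
qed

text \<open>Only the augmentation changes, and the complex in positive degrees does not see
  it.\<close>

lemma resolution_iso:
  assumes "projective_resolution C X d" "u \<in> Hom C X X'" "v \<in> Hom C X' X"
    "u \<star> v = Ident C X'" "v \<star> u = Ident C X"
  defines "d' \<equiv> \<lambda>k. if k = 0 then u \<star> d 0 else d k"
  shows "projective_resolution C X' d'" "ext_vanishes C d' (Suc n) Y = ext_vanishes C d (Suc n) Y"
proof -
  note d = resolutionD[OF assms(1)]
  have ud: "u \<star> d 0 \<in> Hom C (Dom C (d 0)) X'" using Comp_in_Hom[OF d(2) assms(2)] .
  have dom: "Dom C (d' k) = Dom C (d k)" for k using HomD(2)[OF ud] by (simp add: d'_def)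
  have mono: "is_mono C u" unfolding mono_iff[OF assms(2)]
  proof (intro allI ballI impI)
    fix W g h assume g: "g \<in> Hom C W X" and h: "h \<in> Hom C W X" and eq: "u \<star> g = u \<star> h"
    have "v \<star> u \<star> g = v \<star> u \<star> h"
      using Comp_assoc[OF g assms(2,3)] Comp_assoc[OF h assms(2,3)] eq by simp
    then show "g = h" using assms(5) Comp_Ident_left[OF g] Comp_Ident_left[OF h] by simp
  qed
  have "exact_pair C (d' (Suc k)) (d' k)" for k
    using exact_pair_mono_comp[OF mono assms(2) d(2)] d(3)[of k] d(3)[of 0] by (simp add: d'_def)
  moreover have "is_epi C (d' 0)" "Cod C (d' 0) = X'"
    using epi_comp[OF d(1) iso_epi[OF assms(2-4)] d(2) assms(2)] HomD(3)[OF ud]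
    by (simp_all add: d'_def)
  ultimately show "projective_resolution C X' d'"
    using d(4) unfolding projective_resolution_def Proj_def dom by simp
  show "ext_vanishes C d' (Suc n) Y = ext_vanishes C d (Suc n) Y"
    unfolding ext_vanishes_Suc dom by (simp add: d'_def)
qed

section \<open>Bounding dimensions by the vanishing of Ext in a single degree\<close>

lemma proj_dim_le_if_ext_vanishes:
  assumes "projective_resolution C X d" "\<And>Y. Y \<in> Obj C \<Longrightarrow> ext_vanishes C d (Suc n) Y"
  shows "proj_dim C X \<le> enat n"
  using assms
proof (induction n arbitrary: X d)
  case 0
  note d = resolutionD[OF 0(1)]
  obtain m u where m: "is_kernel C (d 0) m" "m \<in> Hom C (Dom C m) (Dom C (d 0))"
    "u \<in> Hom C (Dom C (d 1)) (Dom C m)" "m \<star> u = d 1"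
    "projective_resolution C (Dom C m) (\<lambda>n. if n = 0 then u else d (Suc n))"
    using resolution_shift[OF 0(1)] .
  let ?K = "Dom C m"
  note d' = resolutionD[OF m(5)]
  have K: "?K \<in> Obj C" using HomD[OF m(2)] by blast
  have u2: "u \<star> d 2 = Zero C (Dom C (d 2)) ?K"
    using d'(8)[of 0] HomD(3)[OF m(3)] by (simp add: numeral_2_eq_2)
  have epi: "is_epi C u" using d'(1) by simp
  \<comment> \<open>\<open>u\<close> is a cocycle with values in the syzygy. Being a coboundary, it
    yields \<open>g\<close> with \<open>g \<star> m \<star> u = u\<close>, and cancelling
    \<open>u\<close> makes \<open>g\<close> a retraction of \<open>m\<close>; hence \<open>X\<close>
    is a retract of the projective \<open>Dom C (d 0)\<close>.\<close>
  obtain g where g: "g \<in> Hom C (Dom C (d 0)) ?K" "g \<star> d 1 = u"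
    using 0(2)[OF K] m(3) u2 unfolding ext_vanishes_Suc by (auto simp: numeral_2_eq_2)
  have "g \<star> m \<star> u = Ident C ?K \<star> u"
    using Comp_assoc[OF m(3,2) g(1)] m(4) g(2) Comp_Ident_left[OF m(3)] by simp
  then have "g \<star> m = Ident C ?K"
    using epi_cancel[OF epi m(3) Comp_in_Hom[OF m(2) g(1)] Ident_in_Hom[OF K]] by blast
  then obtain s where "s \<in> Hom C X (Dom C (d 0))" "d 0 \<star> s = Ident C X"
    using split_cokernel[OF epi_cokernel_of_kernel[OF d(1) m(1)] m(2) d(2) g(1)] by blast
  then show ?case using proj_dim_projective projective_retract[OF d(4) d(2)] by blast
next
  case (Suc n)
  note d = resolutionD[OF Suc(2)]
  obtain m u where m: "is_kernel C (d 0) m" "m \<in> Hom C (Dom C m) (Dom C (d 0))"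
    "u \<in> Hom C (Dom C (d 1)) (Dom C m)" "m \<star> u = d 1"
    "projective_resolution C (Dom C m) (\<lambda>n. if n = 0 then u else d (Suc n))"
    using resolution_shift[OF Suc(2)] .
  let ?d = "\<lambda>n. if n = 0 then u else d (Suc n)"
  have dom: "Dom C (?d n) = Dom C (d (Suc n))" for n using HomD(2)[OF m(3)] by simp
  \<comment> \<open>Degree \<open>Suc n\<close> of the shifted resolution is degree
    \<open>Suc (Suc n)\<close> of \<open>d\<close>.\<close>
  have "ext_vanishes C ?d (Suc n) Y" if "Y \<in> Obj C" for Y
    using Suc(3)[OF that] unfolding ext_vanishes_Suc dom by simp
  then have "proj_dim C (Dom C m) \<le> enat n" using Suc(1)[OF m(5)] by blast
  then show ?case using proj_dim_syzygy[OF d(4) d(1,2) m(1)] by blast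
qed

text \<open>Dimension shifting by a diagram chase. Lift the cocycle \<open>f\<close> to
  \<open>g\<close> with values in \<open>I\<close>; then \<open>g \<star> d (Suc (Suc n))\<close>
  comes from a cocycle \<open>h\<close> with values in \<open>Y\<close>, which is the coboundary of
  some \<open>u\<close>. The difference \<open>g \<boxminus> (j \<star> u)\<close> extends over
  \<open>d (Suc n)\<close> by injectivity, and composing with \<open>c\<close> gives
  \<open>f\<close> back.\<close>

lemma ext_vanishes_cosyzygy:
  assumes "projective_resolution C X d" "ext_vanishes C d (Suc (Suc n)) Y"
    "injective_obj C I" "j \<in> Hom C Y I" "c \<in> Hom C I Y'" "is_kernel C c j" "is_epi C c"
  shows "ext_vanishes C d (Suc n) Y'"
  unfolding ext_vanishes_Suc
proof (intro ballI impI)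
  note d = resolutionD[OF assms(1)]
  let ?P = "\<lambda>k. Dom C (d k)"
  let ?d1 = "d (Suc n)" and ?d2 = "d (Suc (Suc n))" and ?d3 = "d (Suc (Suc (Suc n)))"
  fix f assume f: "f \<in> Hom C (?P (Suc n)) Y'" "f \<star> ?d2 = Zero C (?P (Suc (Suc n))) Y'"
  have I: "I \<in> Obj C" using HomD[OF assms(4)] by blast
  have d1: "?d1 \<in> Hom C (?P (Suc n)) (?P n)" and d2: "?d2 \<in> Hom C (?P (Suc (Suc n))) (?P (Suc n))"
    and d3: "?d3 \<in> Hom C (?P (Suc (Suc (Suc n)))) (?P (Suc (Suc n)))" using d(7) by blast+
  have j: "c \<star> j = Zero C Y Y'"
    using is_kernelD(3)[OF assms(6)] HomD(2)[OF assms(4)] HomD(3)[OF assms(5)] by simp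
  obtain g where g: "g \<in> Hom C (?P (Suc n)) I" "c \<star> g = f"
    using projective_lift[OF d(4) assms(7,5) f(1)] .
  have "c \<star> (g \<star> ?d2) = Zero C (?P (Suc (Suc n))) Y'"
    using Comp_assoc[OF d2 g(1) assms(5)] g(2) f(2) by simp
  then obtain h where h: "h \<in> Hom C (?P (Suc (Suc n))) Y" "j \<star> h = g \<star> ?d2"
    using kernel_factor[OF assms(6,5,4) Comp_in_Hom[OF d2 g(1)]] by blast
  have d23: "?d2 \<star> ?d3 = Zero C (?P (Suc (Suc (Suc n)))) (?P (Suc n))"
    using d(8)[of "Suc (Suc n)"] d(6)[of "Suc n"] by simp
  have "j \<star> (h \<star> ?d3) = Zero C (?P (Suc (Suc (Suc n)))) I"
    using Comp_assoc[OF d3 h(1) assms(4)] h(2) Comp_assoc[OF d3 d2 g(1)] d23 Comp_Zero_right[OF g(1) d(5)]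
    by simp
  then have "h \<star> ?d3 = Zero C (?P (Suc (Suc (Suc n)))) Y"
    using mono_comp_Zero[OF kernel_mono[OF assms(6)] assms(4) Comp_in_Hom[OF d3 h(1)]] by blast
  then obtain u where u: "u \<in> Hom C (?P (Suc n)) Y" "u \<star> ?d2 = h"
    using assms(2) h(1) unfolding ext_vanishes_Suc by blast
  have ju: "j \<star> u \<in> Hom C (?P (Suc n)) I" using Comp_in_Hom[OF u(1) assms(4)] .
  have gd: "g \<star> ?d2 \<in> Hom C (?P (Suc (Suc n))) I" using Comp_in_Hom[OF d2 g(1)] .
  have "(g \<boxminus> (j \<star> u)) \<star> ?d2 = Zero C (?P (Suc (Suc n))) I"
    using Comp_Minus_left[OF d2 g(1) ju] Comp_assoc[OF d2 u(1) assms(4)] u(2) h(2)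
      Minus_eq_Zero_iff[OF gd gd] by simp
  then obtain w where "w \<in> Hom C (Cod C ?d1) I" and w1: "w \<star> ?d1 = g \<boxminus> (j \<star> u)"
    using exact_injective_extend[OF d(3) assms(3) Minus_in_Hom[OF g(1) ju]] by blast
  then have w: "w \<in> Hom C (?P n) I" "w \<star> ?d1 = g \<boxminus> (j \<star> u)" unfolding d(6) by blast+
  have "c \<star> (j \<star> u) = Zero C (?P (Suc n)) Y'"
    using Comp_assoc[OF u(1) assms(4,5)] j Comp_Zero_left[OF u(1) HomD(5)[OF assms(5)]] by simp
  then have "c \<star> (g \<boxminus> (j \<star> u)) = f"
    using Comp_Minus_right[OF g(1) ju assms(5)] g(2) Minus_Zero[OF f(1)] by simp
  then have "c \<star> w \<star> ?d1 = f" using Comp_assoc[OF d1 w(1) assms(5)] w(2) by simp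
  then show "\<exists>w \<in> Hom C (?P n) Y'. w \<star> ?d1 = f" using Comp_in_Hom[OF w(1) assms(5)] by blast
qed

text \<open>The same chase one degree lower, starting from the augmentation \<open>d 0\<close> in
  place of a cocycle.\<close>

lemma epi_splits_if_ext_vanishes:
  assumes "projective_resolution C Z d" "ext_vanishes C d (Suc 0) Y"
    "j \<in> Hom C Y I" "c \<in> Hom C I Z" "is_kernel C c j" "is_epi C c"
  obtains s where "s \<in> Hom C Z I" "c \<star> s = Ident C Z"
proof -
  note d = resolutionD[OF assms(1)]
  let ?P = "\<lambda>k. Dom C (d k)"
  have d1: "d 1 \<in> Hom C (?P 1) (?P 0)" and d2: "d 2 \<in> Hom C (?P 2) (?P 1)"
    using d(7)[of 0] d(7)[of 1] by (simp_all add: numeral_2_eq_2)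
  have d01: "d 0 \<star> d 1 = Zero C (?P 1) Z" and d12: "d 1 \<star> d 2 = Zero C (?P 2) (?P 0)"
    using d(8)[of 0] d(8)[of 1] HomD(3)[OF d(2)] d(6)[of 0] by (simp_all add: numeral_2_eq_2)
  obtain a where a: "a \<in> Hom C (?P 0) I" "c \<star> a = d 0"
    using projective_lift[OF d(4) assms(6,4) d(2)] .
  have ad: "a \<star> d 1 \<in> Hom C (?P 1) I" using Comp_in_Hom[OF d1 a(1)] .
  have "c \<star> (a \<star> d 1) = Zero C (?P 1) Z" using Comp_assoc[OF d1 a(1) assms(4)] a(2) d01 by simp
  then obtain b where b: "b \<in> Hom C (?P 1) Y" "j \<star> b = a \<star> d 1"
    using kernel_factor[OF assms(5,4,3) ad] by blast
  have "j \<star> (b \<star> d 2) = Zero C (?P 2) I"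
    using Comp_assoc[OF d2 b(1) assms(3)] b(2) Comp_assoc[OF d2 d1 a(1)] d12 Comp_Zero_right[OF a(1) d(5)]
    by simp
  then have "b \<star> d 2 = Zero C (?P 2) Y"
    using mono_comp_Zero[OF kernel_mono[OF assms(5)] assms(3) Comp_in_Hom[OF d2 b(1)]] by blast
  then obtain w where w: "w \<in> Hom C (?P 0) Y" "w \<star> d 1 = b"
    using assms(2) b(1) unfolding ext_vanishes_Suc by (auto simp: numeral_2_eq_2)
  have jw: "j \<star> w \<in> Hom C (?P 0) I" using Comp_in_Hom[OF w(1) assms(3)] .
  have m: "a \<boxminus> (j \<star> w) \<in> Hom C (?P 0) I" using Minus_in_Hom[OF a(1) jw] .
  have "(a \<boxminus> (j \<star> w)) \<star> d 1 = Zero C (?P 1) I"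
    using Comp_Minus_left[OF d1 a(1) jw] Comp_assoc[OF d1 w(1) assms(3)] w(2) b(2)
      Minus_eq_Zero_iff[OF ad ad] by simp
  moreover have "is_cokernel C (d 1) (d 0)" using exact_pair_epi_cokernel[OF d(3) d(1)] by simp
  \<comment> \<open>The corrected lift \<open>a \<boxminus> (j \<star> w)\<close> kills
    \<open>d 1\<close>, so it descends along the cokernel \<open>d 0\<close> of \<open>d 1\<close>
    to an arrow out of \<open>Z\<close>.\<close>
  ultimately obtain s where s: "s \<in> Hom C Z I" "s \<star> d 0 = a \<boxminus> (j \<star> w)"
    using cokernel_factor[OF _ d1 d(2) m] by blast
  have Z: "Z \<in> Obj C" using HomD[OF d(2)] by blast
  have "c \<star> j = Zero C Y Z"
    using is_kernelD(3)[OF assms(5)] HomD(2)[OF assms(3)] HomD(3)[OF assms(4)] by simp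
  then have "c \<star> (j \<star> w) = Zero C (?P 0) Z"
    using Comp_assoc[OF w(1) assms(3,4)] Comp_Zero_left[OF w(1) Z] by simp
  then have "c \<star> (a \<boxminus> (j \<star> w)) = d 0"
    using Comp_Minus_right[OF a(1) jw assms(4)] a(2) Minus_Zero[OF d(2)] by simp
  then have "c \<star> s \<star> d 0 = Ident C Z \<star> d 0"
    using Comp_assoc[OF d(2) s(1) assms(4)] s(2) Comp_Ident_left[OF d(2)] by simp
  then have "c \<star> s = Ident C Z"
    using epi_cancel[OF d(1,2) Comp_in_Hom[OF s(1) assms(4)] Ident_in_Hom[OF Z]] by blast
  then show ?thesis using that s(1) by blast
qed

text \<open>Induction on cosyzygies. The resolution is chosen separately for each \<open>X\<close>,
  so vanishing may be checked on whichever one is convenient.\<close>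

lemma inj_dim_le_if_ext_vanishes:
  assumes "enough_injectives C" "Y \<in> Obj C"
    "\<And>X. X \<in> Obj C \<Longrightarrow> \<exists>d. projective_resolution C X d \<and> ext_vanishes C d (Suc n) Y"
  shows "inj_dim C Y \<le> enat n"
  using assms(2,3)
proof (induction n arbitrary: Y)
  case (0 Y)
  obtain I j where I: "injective_obj C I" "j \<in> Hom C Y I" "is_mono C j"
    using assms(1) 0(1) unfolding enough_injectives_def Inj_def by blast
  obtain c where c: "is_cokernel C j c" using ex_cokernel HomD(1)[OF I(2)] by blast
  have cH: "c \<in> Hom C I (Cod C c)" using is_cokernelD(2)[OF c] HomD(3)[OF I(2)] by simp
  have k: "is_kernel C c j" using mono_kernel_of_cokernel[OF I(3) c] .
  obtain d where d: "projective_resolution C (Cod C c) d" "ext_vanishes C d (Suc 0) Y"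
    using 0(2) HomD(5)[OF cH] by blast
  obtain s where s: "s \<in> Hom C (Cod C c) I" "c \<star> s = Ident C (Cod C c)"
    using epi_splits_if_ext_vanishes[OF d I(2) cH k cokernel_epi[OF c]] .
  obtain u where u: "u \<in> Hom C I Y" "u \<star> j = Ident C Y" using split_kernel[OF k cH I(2) s] .
  show ?case using inj_dim_injective[OF injective_retract[OF I(1) u(1) I(2) u(2)]] .
next
  case (Suc n Y)
  obtain I j where I: "injective_obj C I" "j \<in> Hom C Y I" "is_mono C j"
    using assms(1) Suc(2) unfolding enough_injectives_def Inj_def by blast
  obtain c where c: "is_cokernel C j c" using ex_cokernel HomD(1)[OF I(2)] by blast
  have cH: "c \<in> Hom C I (Cod C c)" using is_cokernelD(2)[OF c] HomD(3)[OF I(2)] by simp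
  have k: "is_kernel C c j" using mono_kernel_of_cokernel[OF I(3) c] .
  have "\<exists>d. projective_resolution C X d \<and> ext_vanishes C d (Suc n) (Cod C c)" if "X \<in> Obj C" for X
    using Suc(3)[OF that] ext_vanishes_cosyzygy[OF _ _ I(1,2) cH k cokernel_epi[OF c]] by blast
  then have "inj_dim C (Cod C c) \<le> enat n" using Suc(1) HomD(5)[OF cH] by blast
  then show ?case using inj_dim_cosyzygy[OF I(1,3,2) c] by blast
qed

text \<open>Names the resolution hidden in the choice operator of \<open>Ext\<close>.\<close>

lemma Ext_resolution:
  assumes "enough_projectives C" "X \<in> Obj C"
  obtains d where "projective_resolution C X d"
    "\<forall>n. \<forall>Y \<in> Obj C. ext_vanishes C d (Suc n) Y \<longleftrightarrow> card (carrier (Ext C (Suc n) X Y)) = 1"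
proof -
  have "projective_resolution C X (SOME d. projective_resolution C X d)"
    using ex_projective_resolution[OF assms] by (rule someI_ex)
  then show ?thesis using that[of "SOME d. projective_resolution C X d"] ext_vanishes_iff_card
    unfolding Ext_def by blast
qed

end

text \<open>All that is extracted from the isomorphisms of extension groups, which need not be
  natural.\<close>

lemma card_carrier_iso:
  assumes "G \<cong> H"
  shows "card (carrier G) = card (carrier H)"
  using assms bij_betw_same_card unfolding is_iso_def iso_def by blast


section \<open>Recollements\<close>

context recollement
begin

sublocale A: abelian_category A + B: abelian_category B + C: abelian_category C
  using abelian by auto

section \<open>The composites of \<open>e\<close> with \<open>i\<close> and with
  \<open>r\<close>\<close>

lemma on_ob_in_Obj:
  "X \<in> Obj A \<Longrightarrow> on_ob i X \<in> Obj B" "Y \<in> Obj B \<Longrightarrow> on_ob e Y \<in> Obj C"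
    "Z \<in> Obj C \<Longrightarrow> on_ob r Z \<in> Obj B"
  using functors unfolding additive_functor_def by auto

text \<open>Each \<open>on_ob i X\<close> lies in the essential image of \<open>i\<close>, which is
  the kernel of \<open>e\<close>.\<close>

lemma e_i_zero:
  assumes "X \<in> Obj A"
  shows "is_zero_object C (on_ob e (on_ob i X))"
proof -
  let ?Y = "on_ob i X"
  have Y: "?Y \<in> Obj B" using on_ob_in_Obj assms by blast
  have "isomorphic_objects B ?Y ?Y"
    unfolding isomorphic_objects_def using B.Ident_in_Hom[OF Y] B.Comp_Ident_left by blast
  then have "?Y \<in> essential_image A B i" using assms Y unfolding essential_image_def by blast
  then show ?thesis unfolding image_i functor_kernel_def by blast
qed

text \<open>The counit of the adjunction between \<open>e\<close> and \<open>r\<close> is invertible because \<open>r\<close> is fully faithful.\<close>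

lemma e_r_iso:
  assumes Z: "Z \<in> Obj C"
  obtains u v where "u \<in> Hom C (on_ob e (on_ob r Z)) Z" "v \<in> Hom C Z (on_ob e (on_ob r Z))"
    "u \<star>\<^bsub>C\<^esub> v = Ident C Z" "v \<star>\<^bsub>C\<^esub> u = Ident C (on_ob e (on_ob r Z))"
proof -
  let ?R = "on_ob r Z"
  let ?E = "on_ob e ?R"
  have R: "?R \<in> Obj B" and E: "?E \<in> Obj C" using on_ob_in_Obj Z by blast+
  obtain \<phi> where bij: "\<And>X Y. X \<in> Obj B \<Longrightarrow> Y \<in> Obj C \<Longrightarrow>
        bij_betw (\<phi> X Y) (Hom C (on_ob e X) Y) (Hom B X (on_ob r Y))"
    and nat: "\<And>X X' Y Y' u v f. \<lbrakk>X \<in> Obj B; X' \<in> Obj B; Y \<in> Obj C; Y' \<in> Obj C;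
        u \<in> Hom B X' X; v \<in> Hom C Y Y'; f \<in> Hom C (on_ob e X) Y\<rbrakk> \<Longrightarrow>
        \<phi> X' Y' (v \<star>\<^bsub>C\<^esub> f \<star>\<^bsub>C\<^esub> on_ar e u) = on_ar r v \<star>\<^bsub>B\<^esub> \<phi> X Y f \<star>\<^bsub>B\<^esub> u"
    using adj_e_r unfolding left_adjoint_def by blast
  have idR: "Ident B ?R \<in> Hom B ?R ?R" using B.Ident_in_Hom[OF R] .
  have e_id: "on_ar e (Ident B ?R) = Ident C ?E"
    using functors(2) R unfolding additive_functor_def by blast
  have r_id: "on_ar r (Ident C Z) = Ident B ?R"
    using functors(6) Z unfolding additive_functor_def by blast
  have r_Hom: "on_ar r v \<in> Hom B (on_ob r X) (on_ob r Y)" if "v \<in> Hom C X Y" for v X Y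
    using functors(6) that unfolding additive_functor_def by blast
  \<comment> \<open>\<open>u\<close> is the counit at \<open>Z\<close>, the arrow adjoint to the
    identity of \<open>?R\<close>.\<close>
  obtain u where u: "u \<in> Hom C ?E Z" "\<phi> ?R Z u = Ident B ?R"
    using bij[OF R Z] idR unfolding bij_betw_def by (metis imageE)
  have \<phi>_comp: "\<phi> ?R Y (v \<star>\<^bsub>C\<^esub> u) = on_ar r v" if v: "v \<in> Hom C Z Y" for v Y
  proof -
    have Y: "Y \<in> Obj C" using C.HomD(5)[OF v] .
    have "\<phi> ?R Y (v \<star>\<^bsub>C\<^esub> u \<star>\<^bsub>C\<^esub> on_ar e (Ident B ?R)) = on_ar r v \<star>\<^bsub>B\<^esub> \<phi> ?R Z u \<star>\<^bsub>B\<^esub> Ident B ?R"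
      using nat[OF R R Z Y idR v u(1)] .
    then show ?thesis
      using u(2) e_id C.Comp_Ident_right[OF C.Comp_in_Hom[OF u(1) v]] B.Comp_Ident_right[OF r_Hom[OF v]]
      by simp
  qed
  have r_bij: "bij_betw (on_ar r) (Hom C Z ?E) (Hom B ?R (on_ob r ?E))"
    using full_faith(3) Z E unfolding fully_faithful_def by blast
  have "\<phi> ?R ?E (Ident C ?E) \<in> Hom B ?R (on_ob r ?E)"
    using bij_betwE[OF bij[OF R E]] C.Ident_in_Hom[OF E] by blast
  then have "\<phi> ?R ?E (Ident C ?E) \<in> on_ar r ` Hom C Z ?E"
    unfolding bij_betw_imp_surj_on[OF r_bij] .
  \<comment> \<open>Fullness of \<open>r\<close> turns the unit at \<open>?R\<close> into the image
    of an arrow \<open>v\<close>, the candidate inverse of the counit.\<close>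
  then obtain v where v: "\<phi> ?R ?E (Ident C ?E) = on_ar r v" "v \<in> Hom C Z ?E" by (rule imageE)
  have "\<phi> ?R ?E (v \<star>\<^bsub>C\<^esub> u) = \<phi> ?R ?E (Ident C ?E)" using \<phi>_comp[OF v(2)] v(1) by simp
  then have vu: "v \<star>\<^bsub>C\<^esub> u = Ident C ?E"
    by (rule inj_onD[OF bij_betw_imp_inj_on[OF bij[OF R E]] _ C.Comp_in_Hom[OF u(1) v(2)] C.Ident_in_Hom[OF E]])
  have uv: "u \<star>\<^bsub>C\<^esub> v \<in> Hom C Z Z" using C.Comp_in_Hom[OF v(2) u(1)] .
  have "u \<star>\<^bsub>C\<^esub> v \<star>\<^bsub>C\<^esub> u = u"
    using C.Comp_assoc[OF u(1) v(2) u(1)] vu C.Comp_Ident_right[OF u(1)] by simp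
  \<comment> \<open>Injectivity of \<phi> gave one composite; faithfulness of \<open>r\<close> gives
    the other.\<close>
  then have eq: "on_ar r (u \<star>\<^bsub>C\<^esub> v) = on_ar r (Ident C Z)"
    using \<phi>_comp[OF uv] u(2) r_id by simp
  have inj: "inj_on (on_ar r) (Hom C Z Z)"
    using full_faith(3) Z unfolding fully_faithful_def bij_betw_def by blast
  show ?thesis
    using that[OF u(1) v(2) inj_onD[OF inj eq uv C.Ident_in_Hom[OF Z]] vu] .
qed

section \<open>The four bounds for a fixed threshold\<close>

context
  fixes t :: nat
  assumes proj_B: "enough_projectives B" and inj_B: "enough_injectives B"
    and proj_C: "enough_projectives C" and inj_C: "enough_injectives C"
    and hom_iso: "homological_iso (int t) B C e"
begin

text \<open>\<open>Suc t\<close> is the first degree above the threshold.\<close>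

lemma card_Ext_e:
  assumes "X \<in> Obj B" "Y \<in> Obj B"
  shows "card (carrier (Ext B (Suc t) X Y)) = card (carrier (Ext C (Suc t) (on_ob e X) (on_ob e Y)))"
proof (rule card_carrier_iso)
  show "Ext B (Suc t) X Y \<cong> Ext C (Suc t) (on_ob e X) (on_ob e Y)"
    using hom_iso assms unfolding homological_iso_def by simp
qed

text \<open>On the side of \<open>C\<close> the second argument is a zero object, which is
  injective.\<close>

lemma inj_dim_i_le:
  assumes "X \<in> Obj A"
  shows "inj_dim B (on_ob i X) \<le> enat t"
proof (rule B.inj_dim_le_if_ext_vanishes[OF inj_B on_ob_in_Obj(1)[OF assms]])
  let ?Y = "on_ob i X"
  have Y: "?Y \<in> Obj B" using on_ob_in_Obj(1)[OF assms] .
  fix W assume W: "W \<in> Obj B"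
  obtain d where d: "projective_resolution B W d"
    "\<forall>n. \<forall>Y \<in> Obj B. ext_vanishes B d (Suc n) Y \<longleftrightarrow> card (carrier (Ext B (Suc n) W Y)) = 1"
    using B.Ext_resolution[OF proj_B W] .
  obtain d' where d': "projective_resolution C (on_ob e W) d'"
    "\<forall>n. \<forall>Y \<in> Obj C. ext_vanishes C d' (Suc n) Y \<longleftrightarrow>
      card (carrier (Ext C (Suc n) (on_ob e W) Y)) = 1"
    using C.Ext_resolution[OF proj_C on_ob_in_Obj(2)[OF W]] .
  have "ext_vanishes C d' (Suc t) (on_ob e ?Y)"
    using C.ext_vanishes_injective[OF d'(1) C.zero_object_injective[OF e_i_zero[OF assms]]] .
  then have "ext_vanishes B d (Suc t) ?Y"
    using d(2)[rule_format, OF Y] d'(2)[rule_format, OF on_ob_in_Obj(2)[OF Y]] card_Ext_e[OF W Y]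
    by simp
  then show "\<exists>d. projective_resolution B W d \<and> ext_vanishes B d (Suc t) ?Y" using d(1) by blast
qed

text \<open>Here the first argument becomes a zero object, which is projective.\<close>

lemma proj_dim_i_le:
  assumes "X \<in> Obj A"
  shows "proj_dim B (on_ob i X) \<le> enat t"
proof -
  let ?X = "on_ob i X"
  have X: "?X \<in> Obj B" using on_ob_in_Obj(1)[OF assms] .
  obtain d where d: "projective_resolution B ?X d"
    "\<forall>n. \<forall>Y \<in> Obj B. ext_vanishes B d (Suc n) Y \<longleftrightarrow> card (carrier (Ext B (Suc n) ?X Y)) = 1"
    using B.Ext_resolution[OF proj_B X] .
  obtain d' where d': "projective_resolution C (on_ob e ?X) d'"
    "\<forall>n. \<forall>Y \<in> Obj C. ext_vanishes C d' (Suc n) Y \<longleftrightarrow>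
      card (carrier (Ext C (Suc n) (on_ob e ?X) Y)) = 1"
    using C.Ext_resolution[OF proj_C on_ob_in_Obj(2)[OF X]] .
  show ?thesis
  proof (rule B.proj_dim_le_if_ext_vanishes[OF d(1)])
    fix Y assume Y: "Y \<in> Obj B"
    have "ext_vanishes C d' (Suc t) (on_ob e Y)"
      using C.ext_vanishes_projective[OF d'(1) C.zero_object_projective[OF e_i_zero[OF assms]]] .
    then show "ext_vanishes B d (Suc t) Y"
      using d(2)[rule_format, OF Y] d'(2)[rule_format, OF on_ob_in_Obj(2)[OF Y]] card_Ext_e[OF X Y] by simp
  qed
qed

text \<open>Vanishing for the projective \<open>P\<close> against \<open>on_ob r Z\<close> passes
  through \<open>e\<close>, and \<open>Z\<close> is a retract of
  \<open>on_ob e (on_ob r Z)\<close>.\<close>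

lemma proj_dim_e_le:
  assumes "projective_obj B P"
  shows "proj_dim C (on_ob e P) \<le> enat t"
proof -
  have P: "P \<in> Obj B" using assms unfolding projective_obj_def by blast
  obtain d where d: "projective_resolution B P d"
    "\<forall>n. \<forall>Y \<in> Obj B. ext_vanishes B d (Suc n) Y \<longleftrightarrow> card (carrier (Ext B (Suc n) P Y)) = 1"
    using B.Ext_resolution[OF proj_B P] .
  obtain d' where d': "projective_resolution C (on_ob e P) d'"
    "\<forall>n. \<forall>Y \<in> Obj C. ext_vanishes C d' (Suc n) Y \<longleftrightarrow>
      card (carrier (Ext C (Suc n) (on_ob e P) Y)) = 1"
    using C.Ext_resolution[OF proj_C on_ob_in_Obj(2)[OF P]] .
  show ?thesis
  proof (rule C.proj_dim_le_if_ext_vanishes[OF d'(1)])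
    fix Z assume Z: "Z \<in> Obj C"
    let ?Y = "on_ob r Z"
    have Y: "?Y \<in> Obj B" using on_ob_in_Obj(3)[OF Z] .
    obtain u v where uv: "u \<in> Hom C (on_ob e ?Y) Z" "v \<in> Hom C Z (on_ob e ?Y)"
      "u \<star>\<^bsub>C\<^esub> v = Ident C Z" using e_r_iso[OF Z] .
    have "ext_vanishes C d' (Suc t) (on_ob e ?Y)"
      using B.ext_vanishes_projective[OF d(1) assms, of t ?Y] d(2)[rule_format, OF Y]
        d'(2)[rule_format, OF on_ob_in_Obj(2)[OF Y]] card_Ext_e[OF P Y] by simp
    then show "ext_vanishes C d' (Suc t) Z" using C.ext_vanishes_retract[OF _ uv d'(1)] by blast
  qed
qed

text \<open>Now \<open>Z\<close> is the first argument, so the resolution of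
  \<open>on_ob e (on_ob r Z)\<close> itself is carried over to \<open>Z\<close> along the invertible
  counit.\<close>

lemma inj_dim_e_le:
  assumes "injective_obj B I"
  shows "inj_dim C (on_ob e I) \<le> enat t"
proof -
  have I: "I \<in> Obj B" using assms unfolding injective_obj_def by blast
  have eI: "on_ob e I \<in> Obj C" using on_ob_in_Obj(2)[OF I] .
  show ?thesis
  proof (rule C.inj_dim_le_if_ext_vanishes[OF inj_C eI])
    fix Z assume Z: "Z \<in> Obj C"
    let ?X = "on_ob r Z"
    have X: "?X \<in> Obj B" using on_ob_in_Obj(3)[OF Z] .
    obtain u v where uv: "u \<in> Hom C (on_ob e ?X) Z" "v \<in> Hom C Z (on_ob e ?X)"
      "u \<star>\<^bsub>C\<^esub> v = Ident C Z" "v \<star>\<^bsub>C\<^esub> u = Ident C (on_ob e ?X)" using e_r_iso[OF Z] .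
    obtain d where d: "projective_resolution B ?X d"
      "\<forall>n. \<forall>Y \<in> Obj B. ext_vanishes B d (Suc n) Y \<longleftrightarrow> card (carrier (Ext B (Suc n) ?X Y)) = 1"
      using B.Ext_resolution[OF proj_B X] .
    obtain d' where d': "projective_resolution C (on_ob e ?X) d'"
      "\<forall>n. \<forall>Y \<in> Obj C. ext_vanishes C d' (Suc n) Y \<longleftrightarrow>
        card (carrier (Ext C (Suc n) (on_ob e ?X) Y)) = 1"
      using C.Ext_resolution[OF proj_C on_ob_in_Obj(2)[OF X]] .
    have "ext_vanishes C d' (Suc t) (on_ob e I)"
      using B.ext_vanishes_injective[OF d(1) assms, of t] d(2)[rule_format, OF I]
        d'(2)[rule_format, OF eI] card_Ext_e[OF X I] by simp
    then show "\<exists>d. projective_resolution C Z d \<and> ext_vanishes C d (Suc t) (on_ob e I)"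
      using C.resolution_iso[OF d'(1) uv] by blast
  qed
qed

end

end

section \<open>The uniform bounds and their finiteness\<close>

theorem proposition3p7:
  fixes A :: "('oA, 'mA) cat" and B :: "('oB, 'mB) cat" and C :: "('oC, 'mC) cat"
    and i :: "('oA, 'mA, 'oB, 'mB) ftor" and e :: "('oB, 'mB, 'oC, 'mC) ftor"
    and q p :: "('oB, 'mB, 'oA, 'mA) ftor" and l r :: "('oC, 'mC, 'oB, 'mB) ftor"
  assumes "recollement A B C i e q p l r"
    and "enough_projectives B" and "enough_injectives B"
    and "enough_projectives C" and "enough_injectives C"
    and "eventually_homological_iso B C e"
  shows "((SUP X \<in> Obj A. inj_dim B (on_ob i X)) < \<infinity> \<and>
          (SUP P \<in> Proj B. proj_dim C (on_ob e P)) < \<infinity> \<and>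
          (SUP X \<in> Obj A. proj_dim B (on_ob i X)) < \<infinity> \<and>
          (SUP I \<in> Inj B. inj_dim C (on_ob e I)) < \<infinity>) \<and>
         (\<forall>t::nat. homological_iso (int t) B C e \<longrightarrow>
          (SUP X \<in> Obj A. inj_dim B (on_ob i X)) \<le> enat t \<and>
          (SUP P \<in> Proj B. proj_dim C (on_ob e P)) \<le> enat t \<and>
          (SUP X \<in> Obj A. proj_dim B (on_ob i X)) \<le> enat t \<and>
          (SUP I \<in> Inj B. inj_dim C (on_ob e I)) \<le> enat t)"
proof -
  interpret recollement A B C i e q p l r by fact
  have bound: "(SUP X \<in> Obj A. inj_dim B (on_ob i X)) \<le> enat t \<and>
      (SUP P \<in> Proj B. proj_dim C (on_ob e P)) \<le> enat t \<and>
      (SUP X \<in> Obj A. proj_dim B (on_ob i X)) \<le> enat t \<and>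
      (SUP I \<in> Inj B. inj_dim C (on_ob e I)) \<le> enat t"
    if t: "homological_iso (int t) B C e" for t :: nat
    using inj_dim_i_le[OF assms(2-5) t] proj_dim_e_le[OF assms(2-5) t]
      proj_dim_i_le[OF assms(2-5) t] inj_dim_e_le[OF assms(2-5) t]
    by (intro conjI SUP_least) (simp_all add: Proj_def Inj_def)
  obtain s where "homological_iso s B C e"
    using assms(6) unfolding eventually_homological_iso_def by blast
  \<comment> \<open>The threshold \<open>s\<close> may be negative; \<open>nat s\<close> replaces it
    by 0 in that case, and raising a threshold only weakens the condition.\<close>
  then have "homological_iso (int (nat s)) B C e" unfolding homological_iso_def by simp
  note b = bound[OF this]
  have fin: "x < \<infinity>" if "x \<le> enat n" for x n using that by (rule le_less_trans) simp
  show ?thesis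
    using b[THEN conjunct1, THEN fin] b[THEN conjunct2, THEN conjunct1, THEN fin]
      b[THEN conjunct2, THEN conjunct2, THEN conjunct1, THEN fin]
      b[THEN conjunct2, THEN conjunct2, THEN conjunct2, THEN fin] bound by blast
qed

end
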